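(* Let $1\le k\le n-1$. Both $\Delta^{NN}_{k,n}$ and $\Delta^{NC}_{k,n}$ are flag unimodular triangulations of $\mathcal{O}_{k,n}$ (via the identification of $I\in V_{k,n}$ with the vertex $\chi_I$).
   Context: $V_{k,n}$ denotes the set of integer vectors $I=(i_1,\dots,i_k)$ with $1\le i_1<\dots<i_k\le n$. Two arcs $(p<p')$, $(q<q')$ cross if $p<q<p'<q'$ or $q<p<q'<p'$; they nest if $p<q<q'<p'$ or $q<p<p'<q'$. $I,J\in V_{k,n}$ are noncrossing if for all $1\le a<b\le k$ with $i_\ell=j_\ell$ for all $a<\ell<b$, the arcs $(i_a<i_b)$ and $(j_a<j_b)$ do not cross; they are nonnesting if for all $1\le a<b\le k$ these arcs do not nest. $\Delta^{NC}_{k,n}$ (resp. $\Delta^{NN}_{k,n}$) is the flag simplicial complex on $V_{k,n}$ whose faces are the sets of pairwise noncrossing (resp. nonnesting) vectors. Let $P_{k,n}=\{(a,b):a\in[k],b\in[n-k]\}$ and $\chi_I\in\{0,1\}^{P_{k,n}}$ with $(\chi_I)_{a,b}=1$ iff $i_a\le a+b-1$. The order polytope is $\mathcal{O}_{k,n}=\{x\in[0,1]^{P_{k,n}}: x_{a,b}\le x_{a,b+1},\ x_{a+1,b}\le x_{a,b}\}$, whose vertices are exactly the $\chi_I$. A simplicial complex on $V_{k,n}$ triangulates $\mathcal{O}_{k,n}$ if the sets $\{\chi_I:I\in\sigma\}$ are affinely independent and the simplices $\mathrm{conv}\{\chi_I:I\in\sigma\}$ cover $\mathcal{O}_{k,n}$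 and meet in common faces; unimodular means each maximal simplex is a lattice basis simplex of $\mathbb{Z}^{P_{k,n}}$ (volume $1/(k(n-k))!$). *)

theory Defs
  imports "HOL-Analysis.Analysis" "HOL-Library.Function_Algebras"
begin

text \<open>Points of R^{P_{k,n}} are represented as functions nat \<times> nat \<Rightarrow> real that vanish
  outside P_{k,n}.  We equip the function space with the pointwise real vector space structure,
  so that the library notions affine_dependent, convex hull and face_of apply.\<close>

instantiation "fun" :: (type, real_vector) real_vector
begin
definition scaleR_fun :: "real \<Rightarrow> ('a \<Rightarrow> 'b) \<Rightarrow> 'a \<Rightarrow> 'b" where
  "scaleR_fun c f = (\<lambda>x. c *\<^sub>R f x)"
instance by standard (auto simp: scaleR_fun_def plus_fun_def scaleR_add_right scaleR_add_left)
end

definition V :: "nat \<Rightarrow> nat \<Rightarrow> nat list set" where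
  "V k n = {I. length I = k \<and> sorted_wrt (<) I \<and> set I \<subseteq> {1..n}}"

definition ent :: "nat list \<Rightarrow> nat \<Rightarrow> nat" where
  "ent I a = I ! (a - 1)"

definition arcs_cross :: "nat \<times> nat \<Rightarrow> nat \<times> nat \<Rightarrow> bool" where
  "arcs_cross A B = (case A of (p, p') \<Rightarrow> case B of (q, q') \<Rightarrow>
      (p < q \<and> q < p' \<and> p' < q') \<or> (q < p \<and> p < q' \<and> q' < p'))"

definition arcs_nest :: "nat \<times> nat \<Rightarrow> nat \<times> nat \<Rightarrow> bool" where
  "arcs_nest A B = (case A of (p, p') \<Rightarrow> case B of (q, q') \<Rightarrow>
      (p < q \<and> q < q' \<and> q' < p') \<or> (q < p \<and> p < p' \<and> p' < q'))"

definition noncrossing :: "nat \<Rightarrow> nat list \<Rightarrow> nat list \<Rightarrow> bool" where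
  "noncrossing k I J =
     (\<forall>a b. 1 \<le> a \<and> a < b \<and> b \<le> k \<and> (\<forall>l. a < l \<and> l < b \<longrightarrow> ent I l = ent J l) \<longrightarrow>
        \<not> arcs_cross (ent I a, ent I b) (ent J a, ent J b))"

definition nonnesting :: "nat \<Rightarrow> nat list \<Rightarrow> nat list \<Rightarrow> bool" where
  "nonnesting k I J =
     (\<forall>a b. 1 \<le> a \<and> a < b \<and> b \<le> k \<longrightarrow>
        \<not> arcs_nest (ent I a, ent I b) (ent J a, ent J b))"

definition DeltaNC :: "nat \<Rightarrow> nat \<Rightarrow> nat list set set" where
  "DeltaNC k n = {\<sigma>. \<sigma> \<subseteq> V k n \<and> (\<forall>I\<in>\<sigma>. \<forall>J\<in>\<sigma>. noncrossing k I J)}"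

definition DeltaNN :: "nat \<Rightarrow> nat \<Rightarrow> nat list set set" where
  "DeltaNN k n = {\<sigma>. \<sigma> \<subseteq> V k n \<and> (\<forall>I\<in>\<sigma>. \<forall>J\<in>\<sigma>. nonnesting k I J)}"

definition simplicial_complex_on :: "'v set \<Rightarrow> 'v set set \<Rightarrow> bool" where
  "simplicial_complex_on Vs \<Delta> =
     ((\<forall>\<sigma>\<in>\<Delta>. \<sigma> \<subseteq> Vs \<and> finite \<sigma>) \<and> (\<forall>\<sigma>\<in>\<Delta>. \<forall>\<tau>. \<tau> \<subseteq> \<sigma> \<longrightarrow> \<tau> \<in> \<Delta>)
      \<and> (\<forall>v\<in>Vs. {v} \<in> \<Delta>))"

definition flag_complex_on :: "'v set \<Rightarrow> 'v set set \<Rightarrow> bool" where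
  "flag_complex_on Vs \<Delta> =
     (simplicial_complex_on Vs \<Delta> \<and>
      (\<forall>\<sigma>. finite \<sigma> \<and> \<sigma> \<subseteq> Vs \<and> (\<forall>u\<in>\<sigma>. \<forall>v\<in>\<sigma>. {u, v} \<in> \<Delta>) \<longrightarrow> \<sigma> \<in> \<Delta>))"

definition Pkn :: "nat \<Rightarrow> nat \<Rightarrow> (nat \<times> nat) set" where
  "Pkn k n = {(a, b). 1 \<le> a \<and> a \<le> k \<and> 1 \<le> b \<and> b \<le> n - k}"

definition chi :: "nat \<Rightarrow> nat \<Rightarrow> nat list \<Rightarrow> (nat \<times> nat \<Rightarrow> real)" where
  "chi k n I = (\<lambda>(a, b). if (a, b) \<in> Pkn k n \<and> ent I a \<le> a + b - 1 then 1 else 0)"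

definition order_polytope :: "nat \<Rightarrow> nat \<Rightarrow> (nat \<times> nat \<Rightarrow> real) set" where
  "order_polytope k n =
     {x. (\<forall>p. p \<notin> Pkn k n \<longrightarrow> x p = 0) \<and>
         (\<forall>p\<in>Pkn k n. 0 \<le> x p \<and> x p \<le> 1) \<and>
         (\<forall>a b. (a, b) \<in> Pkn k n \<and> (a, b + 1) \<in> Pkn k n \<longrightarrow> x (a, b) \<le> x (a, b + 1)) \<and>
         (\<forall>a b. (a, b) \<in> Pkn k n \<and> (a + 1, b) \<in> Pkn k n \<longrightarrow> x (a + 1, b) \<le> x (a, b))}"

definition triangulates :: "nat \<Rightarrow> nat \<Rightarrow> nat list set set \<Rightarrow> bool" where
  "triangulates k n \<Delta> =
     ((\<forall>\<sigma>\<in>\<Delta>. \<not> affine_dependent (chi k n ` \<sigma>)) \<and>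
      (\<Union>\<sigma>\<in>\<Delta>. convex hull (chi k n ` \<sigma>)) = order_polytope k n \<and>
      (\<forall>\<sigma>\<in>\<Delta>. \<forall>\<tau>\<in>\<Delta>.
         (convex hull (chi k n ` \<sigma>) \<inter> convex hull (chi k n ` \<tau>)) face_of convex hull (chi k n ` \<sigma>) \<and>
         (convex hull (chi k n ` \<sigma>) \<inter> convex hull (chi k n ` \<tau>)) face_of convex hull (chi k n ` \<tau>)))"

definition int_lattice :: "(nat \<times> nat) set \<Rightarrow> (nat \<times> nat \<Rightarrow> real) set" where
  "int_lattice P = {z. (\<forall>p\<in>P. z p \<in> \<int>) \<and> (\<forall>p. p \<notin> P \<longrightarrow> z p = 0)}"

text \<open>A lattice basis simplex of Z^P: a finite point set with card P + 1 points in Z^P such that,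
  for some vertex v0, the edge vectors v - v0 generate Z^P over the integers
  (being card P many generators of the rank card P lattice, they form a Z-basis).\<close>
definition lattice_basis_simplex :: "(nat \<times> nat) set \<Rightarrow> (nat \<times> nat \<Rightarrow> real) set \<Rightarrow> bool" where
  "lattice_basis_simplex P S =
     (finite S \<and> card S = card P + 1 \<and> S \<subseteq> int_lattice P \<and>
      (\<exists>v0\<in>S. \<forall>z\<in>int_lattice P. \<exists>c :: (nat \<times> nat \<Rightarrow> real) \<Rightarrow> int.
          z = (\<Sum>v\<in>S - {v0}. of_int (c v) *\<^sub>R (v - v0))))"

definition maximal_face :: "'v set set \<Rightarrow> 'v set \<Rightarrow> bool" where
  "maximal_face \<Delta> \<sigma> = (\<sigma> \<in> \<Delta> \<and> (\<forall>\<tau>\<in>\<Delta>. \<sigma> \<subseteq> \<tau> \<longrightarrow> \<tau> = \<sigma>))"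

definition unimodular :: "nat \<Rightarrow> nat \<Rightarrow> nat list set set \<Rightarrow> bool" where
  "unimodular k n \<Delta> =
     (\<forall>\<sigma>. maximal_face \<Delta> \<sigma> \<longrightarrow> lattice_basis_simplex (Pkn k n) (chi k n ` \<sigma>))"

definition flag_unimodular_triangulation :: "nat \<Rightarrow> nat \<Rightarrow> nat list set set \<Rightarrow> bool" where
  "flag_unimodular_triangulation k n \<Delta> =
     (flag_complex_on (V k n) \<Delta> \<and> triangulates k n \<Delta> \<and> unimodular k n \<Delta>)"

end

theory Submission
  imports Defs
begin

text \<open>A nonnegative combination of the vectors \<open>\<chi>\<^sub>I\<close> remembers exactly, for every position \<open>a\<close>, the
  distribution of the \<open>a\<close>-th entries.  Adding one position at a time, a weight on
  \<open>(k + 1)\<close>-vectors is a coupling of a weight on \<open>k\<close>-vectors with the distribution of the last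
  entry \<open>p\<close>, and both the nonnesting and the noncrossing condition say that this coupling is
  greedy: the entries \<open>p\<close> are served in increasing order, each by the available vectors (those
  with all entries below \<open>p\<close>) of highest priority, where priority is the colexicographic order
  for nonnesting and its converse (parenthesis matching) for noncrossing.  Greedy couplings exist,
  are unique and preserve integrality, so every point of the cone over the order polytope
  has exactly one representation supported on a face, integral if the point is.

  For unimodularity let \<open>\<sigma>\<close> be a maximal face with vertex sum \<open>s\<close>, and represent \<open>M s + \<chi>\<^sub>J\<close> for
  all \<open>M\<close>.  Two of the representations with a common support differ by a positive multiple
  of the representation of \<open>s\<close>, so the support is \<open>\<sigma>\<close>, and \<open>\<chi>\<^sub>J\<close> is an integral affine
  combination of the vertices of \<open>\<sigma>\<close>.\<close>

subsection \<open>Greedy couplings\<close>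

text \<open>Read \<open>L b a\<close> as: \<open>b\<close> is served before \<open>a\<close>. With
  capacities \<open>u\<close>, \<open>a\<close> receives something only once \<open>b\<close> is
  full.\<close>

definition fills :: "('a \<Rightarrow> 'a \<Rightarrow> bool) \<Rightarrow> 'a set \<Rightarrow> ('a \<Rightarrow> real) \<Rightarrow> ('a \<Rightarrow> real) \<Rightarrow> bool" where
  "fills L A u w \<longleftrightarrow> (\<forall>a\<in>A. 0 \<le> w a \<and> w a \<le> u a) \<and>
     (\<forall>a\<in>A. \<forall>b\<in>A. L b a \<longrightarrow> 0 < w a \<longrightarrow> w b = u b)"

text \<open>The element of lowest priority is split off. If the others can absorb \<open>v\<close>
  it receives nothing; otherwise they are filled and it takes the remainder, a difference of
  integers if the data are integral.\<close>

lemma fills_exists: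
  fixes u :: "'a \<Rightarrow> real"
  assumes "finite A" "asymp_on A L" "transp_on A L" "totalp_on A L"
    and "\<And>a. a \<in> A \<Longrightarrow> 0 \<le> u a" and "0 \<le> v" "v \<le> sum u A"
  shows "\<exists>w. fills L A u w \<and> sum w A = v \<and>
           (v \<in> \<int> \<longrightarrow> (\<forall>a\<in>A. u a \<in> \<int>) \<longrightarrow> (\<forall>a\<in>A. w a \<in> \<int>))"
  using assms
proof (induction "card A" arbitrary: A v)
  case 0
  then show ?case by (auto simp: fills_def)
next
  case (Suc N)
  then have "A \<noteq> {}" by auto
  then obtain m where m: "m \<in> A" "\<forall>x\<in>A. x \<noteq> m \<longrightarrow> \<not> L m x"
    using Finite_Set.bex_max_element[OF Suc.prems(1-2) Suc.prems(3)] by blast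
  let ?B = "A - {m}"
  have sub: "?B \<subseteq> A" by auto
  have props: "N = card ?B" "finite ?B" "asymp_on ?B L" "transp_on ?B L" "totalp_on ?B L"
    using Suc.hyps(2) Suc.prems m(1) asymp_on_subset[OF _ sub] transp_on_subset[OF _ sub]
      totalp_on_subset[OF _ sub] by auto
  have irr: "\<not> L m m" using Suc.prems(2) m(1) by (auto dest: asymp_onD)
  have sumA: "sum f A = f m + sum f ?B" for f :: "'a \<Rightarrow> real"
    using Suc.prems(1) m(1) by (simp add: sum.remove)
  show ?case
  proof (cases "v \<le> sum u ?B")
    case True
    then obtain w where w: "fills L ?B u w" "sum w ?B = v"
        "v \<in> \<int> \<longrightarrow> (\<forall>a\<in>?B. u a \<in> \<int>) \<longrightarrow> (\<forall>a\<in>?B. w a \<in> \<int>)"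
      using Suc.hyps(1)[OF props] Suc.prems by auto
    have "fills L A u (w(m := 0))" using w(1) m irr Suc.prems(5) unfolding fills_def by auto
    moreover have "sum (w(m := 0)) A = v" using w(2) by (simp add: sumA)
    ultimately show ?thesis using w(3) by (intro exI[of _ "w(m := 0)"]) auto
  next
    case False
    let ?w = "u(m := v - sum u ?B)"
    have "fills L A u ?w" using False m irr Suc.prems(5,7) unfolding fills_def sumA by auto
    moreover have "sum ?w A = v" by (simp add: sumA)
    moreover have "v \<in> \<int> \<longrightarrow> (\<forall>a\<in>A. u a \<in> \<int>) \<longrightarrow> (\<forall>a\<in>A. ?w a \<in> \<int>)"
      by (auto intro!: Ints_diff Ints_sum)
    ultimately show ?thesis by blast
  qed
qed

text \<open>Two fills of equal total that differ at \<open>a\<close> differ the other way at some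
  \<open>b\<close>. Whichever of the two has priority would have to be full in the fill that gives
  it less.\<close>

lemma fills_unique:
  assumes "finite A" "totalp_on A L" "fills L A u w" "fills L A u w'"
    and "sum w A = sum w' A" and "a \<in> A"
  shows "w a = w' a"
proof -
  have no_deficit: False
    if F: "fills L A u f" "fills L A u g" and S: "sum f A = sum g A" and lt: "f a < g a" "a \<in> A"
    for f g a
  proof -
    have "\<exists>b\<in>A. g b < f b"
    proof (rule ccontr)
      assume "\<not> (\<exists>b\<in>A. g b < f b)"
      then have "sum f A < sum g A"
        using lt by (intro sum_strict_mono_ex1[OF assms(1)]) (auto simp: not_less)
      with S show False by simp
    qed
    then obtain b where b: "b \<in> A" "g b < f b" by blast
    have "a \<noteq> b" using b lt by auto
    then have "L a b \<or> L b a" using totalp_onD[OF assms(2)] b lt by blast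
    then show False
    proof
      assume "L a b"
      then have "f a = u a" using F b lt unfolding fills_def by (meson le_less_trans)
      then show False using F(2) lt by (auto simp: fills_def)
    next
      assume "L b a"
      then have "g b = u b" using F b lt unfolding fills_def by (meson le_less_trans)
      then show False using F(1) b by (auto simp: fills_def)
    qed
  qed
  show ?thesis
    using no_deficit[OF assms(3,4,5) _ assms(6)] no_deficit[OF assms(4,3) assms(5)[symmetric] _ assms(6)]
    by (meson linorder_neqE)
qed

definition greedy_coupling ::
    "('a \<Rightarrow> 'a \<Rightarrow> bool) \<Rightarrow> 'a set \<Rightarrow> ('a \<Rightarrow> nat) \<Rightarrow> nat \<Rightarrow> ('a \<Rightarrow> nat \<Rightarrow> real) \<Rightarrow> bool" where
  "greedy_coupling L A e n w \<longleftrightarrow>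
     (\<forall>a\<in>A. \<forall>p. 0 \<le> w a p) \<and>
     (\<forall>a\<in>A. \<forall>p. 0 < w a p \<longrightarrow> e a < p \<and> p \<le> n) \<and>
     (\<forall>a\<in>A. \<forall>b\<in>A. \<forall>p q. L b a \<and> e b < p \<and> p < q \<longrightarrow> \<not> (0 < w a p \<and> 0 < w b q))"

lemma greedy_couplingD:
  assumes "greedy_coupling L A e n w" "a \<in> A"
  shows "0 \<le> w a p" "\<not> (e a < p \<and> p \<le> n) \<Longrightarrow> w a p = 0"
proof -
  show *: "0 \<le> w a p" using assms unfolding greedy_coupling_def by blast
  show "w a p = 0" if "\<not> (e a < p \<and> p \<le> n)"
  proof -
    have "\<not> 0 < w a p" using assms that unfolding greedy_coupling_def by blast
    with * show ?thesis by simp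
  qed
qed

lemma greedy_coupling_cong:
  assumes "\<And>a p. a \<in> A \<Longrightarrow> w a p = w' a p"
  shows "greedy_coupling L A e n w \<longleftrightarrow> greedy_coupling L A e n w'"
  unfolding greedy_coupling_def
  by (intro arg_cong2[where f = conj] ball_cong refl all_cong1) (simp_all only: assms)

text \<open>If \<open>a\<close> is used at \<open>p\<close>, mass that a preferred available row
  still sends to the right of \<open>p\<close> would be an inversion. So each column is a fill whose
  capacities are what the earlier columns have left of the rows.\<close>

lemma greedy_coupling_fills:
  assumes "greedy_coupling L A e n w" "p \<le> n"
  shows "fills L {a\<in>A. e a < p} (\<lambda>a. \<Sum>q\<in>{p..n}. w a q) (\<lambda>a. w a p)"
  unfolding fills_def
proof (intro conjI ballI impI)
  note nonneg = greedy_couplingD(1)[OF assms(1)]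
  fix a assume a: "a \<in> {a\<in>A. e a < p}"
  show "0 \<le> w a p" using a nonneg by auto
  show "w a p \<le> (\<Sum>q\<in>{p..n}. w a q)"
    using a assms(2) nonneg by (intro member_le_sum) auto
  fix b assume b: "b \<in> {a\<in>A. e a < p}" "L b a" "0 < w a p"
  have "w b q = 0" if "p < q" for q
  proof -
    have "\<not> (0 < w a p \<and> 0 < w b q)"
      using assms(1) a b(1,2) that unfolding greedy_coupling_def by blast
    then show ?thesis using b(1,3) nonneg[of b q] by auto
  qed
  then have "(\<Sum>q\<in>{p..n} - {p}. w b q) = 0"
    by (intro sum.neutral) (auto simp: order_le_less)
  then show "w b p = (\<Sum>q\<in>{p..n}. w b q)"
    using assms(2) by (simp add: sum.remove[of "{p..n}" p])
qed

text \<open>Strong induction on the column: once the earlier columns agree, so do the row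
  remainders, and column \<open>p\<close> is a fill of these with prescribed total.\<close>

lemma greedy_coupling_unique:
  assumes "finite A" "totalp_on A L" "greedy_coupling L A e n w" "greedy_coupling L A e n w'"
    and rows: "\<And>a. a \<in> A \<Longrightarrow> (\<Sum>p\<le>n. w a p) = (\<Sum>p\<le>n. w' a p)"
    and cols: "\<And>p. p \<le> n \<Longrightarrow> (\<Sum>a\<in>A. w a p) = (\<Sum>a\<in>A. w' a p)"
    and "a \<in> A"
  shows "w a p = w' a p"
  using assms(7)
proof (induction p arbitrary: a rule: less_induct)
  case (less p)
  let ?B = "{a\<in>A. e a < p}"
  show ?case
  proof (cases "e a < p \<and> p \<le> n")
    case True
    have tail: "(\<Sum>q\<in>{p..n}. f q) = (\<Sum>q\<le>n. f q) - (\<Sum>q<p. f q)" for f :: "nat \<Rightarrow> real"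
    proof -
      have "{..n} = {..<p} \<union> {p..n}" using True by auto
      then show ?thesis by (simp add: sum.union_disjoint ivl_disj_int)
    qed
    \<comment> \<open>Rows not yet available carry no mass in column \<open>p\<close>, so the total
      of the fill is the whole column sum.\<close>
    have restr: "sum (\<lambda>a. f a p) ?B = sum (\<lambda>a. f a p) A" if "greedy_coupling L A e n f" for f
      using assms(1) greedy_couplingD[OF that] by (intro sum.mono_neutral_left) auto
    have eq: "(\<Sum>q\<in>{p..n}. w a q) = (\<Sum>q\<in>{p..n}. w' a q)" if "a \<in> ?B" for a
      using that less.IH rows by (auto simp: tail)
    have "fills L ?B (\<lambda>a. \<Sum>q\<in>{p..n}. w a q) (\<lambda>a. w' a p)"
      using greedy_coupling_fills[OF assms(4), of p] True eq by (simp add: fills_def)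
    moreover have "fills L ?B (\<lambda>a. \<Sum>q\<in>{p..n}. w a q) (\<lambda>a. w a p)"
      using greedy_coupling_fills[OF assms(3), of p] True by simp
    moreover have "totalp_on ?B L" using assms(2) by (auto intro: totalp_on_subset)
    moreover have "(\<Sum>a\<in>?B. w a p) = (\<Sum>a\<in>?B. w' a p)"
      using True cols by (simp add: restr[OF assms(3)] restr[OF assms(4)])
    ultimately show ?thesis
      using fills_unique[of ?B L _ "\<lambda>a. w a p" "\<lambda>a. w' a p" a] assms(1) True less.prems by auto
  next
    case False
    then show ?thesis
      using greedy_couplingD(2)[OF assms(3) less.prems] greedy_couplingD(2)[OF assms(4) less.prems]
      by simp
  qed
qed

text \<open>Columns are filled from left to right. \<open>dom\<close> is a Hall-type condition: the
  rows available at \<open>p\<close> can cover the demand of all columns up to \<open>p\<close>, so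
  the greedy process never gets stuck.\<close>

lemma greedy_coupling_exists:
  fixes u :: "'a \<Rightarrow> real" and v :: "nat \<Rightarrow> real"
  assumes "finite A" "asymp_on A L" "transp_on A L" "totalp_on A L"
    and u: "\<And>a. a \<in> A \<Longrightarrow> 0 \<le> u a" and v: "\<And>p. 0 \<le> v p" "v 0 = 0"
    and dom: "\<And>p. p \<le> n \<Longrightarrow> (\<Sum>q\<le>p. v q) \<le> (\<Sum>a\<in>{a\<in>A. e a < p}. u a)"
    and total: "(\<Sum>q\<le>n. v q) = sum u A"
  shows "\<exists>w. greedy_coupling L A e n w \<and> (\<forall>a\<in>A. (\<Sum>p\<le>n. w a p) = u a) \<and>
           (\<forall>p\<le>n. (\<Sum>a\<in>A. w a p) = v p) \<and>
           ((\<forall>a\<in>A. u a \<in> \<int>) \<longrightarrow> (\<forall>p. v p \<in> \<int>) \<longrightarrow> (\<forall>a\<in>A. \<forall>p. w a p \<in> \<int>))"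
proof -
  \<comment> \<open>Priority is expressed here as fullness of the preferred row at column
    \<open>p\<close>; unlike a ban on later use, this depends only on the columns built so
    far.\<close>
  define Inv where "Inv N w \<longleftrightarrow> (\<forall>a\<in>A. \<forall>p. 0 \<le> w a p) \<and>
     (\<forall>a\<in>A. \<forall>p. 0 < w a p \<longrightarrow> e a < p \<and> p \<le> N) \<and>
     (\<forall>p\<le>N. (\<Sum>a\<in>A. w a p) = v p) \<and> (\<forall>a\<in>A. (\<Sum>p\<le>N. w a p) \<le> u a) \<and>
     (\<forall>a\<in>A. \<forall>b\<in>A. \<forall>p. L b a \<and> e b < p \<and> 0 < w a p \<longrightarrow> (\<Sum>q\<le>p. w b q) = u b) \<and>
     ((\<forall>a\<in>A. u a \<in> \<int>) \<longrightarrow> (\<forall>p. v p \<in> \<int>) \<longrightarrow> (\<forall>a\<in>A. \<forall>p. w a p \<in> \<int>))"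
    for N and w :: "'a \<Rightarrow> nat \<Rightarrow> real"
  have "\<exists>w. Inv N w" if "N \<le> n" for N
    using that
  proof (induction N)
    case 0
    have "Inv 0 (\<lambda>_ _. 0)" unfolding Inv_def using u v(2) by simp
    then show ?case by blast
  next
    case (Suc N)
    then obtain w where w: "Inv N w" by auto
    have nonneg: "0 \<le> w a p" if "a \<in> A" for a p using w that by (simp add: Inv_def)
    have supp: "w a p = 0" if "a \<in> A" "\<not> (e a < p \<and> p \<le> N)" for a p
    proof -
      have "\<not> 0 < w a p" using w that unfolding Inv_def by blast
      then show ?thesis using nonneg[OF that(1), of p] by simp
    qed
    let ?B = "{a\<in>A. e a < Suc N}"
    let ?r = "\<lambda>a. u a - (\<Sum>p\<le>N. w a p)"
    have B: "finite ?B" "asymp_on ?B L" "transp_on ?B L" "totalp_on ?B L"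
      using assms(1-4) by (auto intro: asymp_on_subset transp_on_subset totalp_on_subset)
    \<comment> \<open>Every row used in a column up to \<open>N\<close> is available at
      \<open>Suc N\<close>, so the available rows have lost exactly the demand of those
      columns.\<close>
    have used: "(\<Sum>a\<in>?B. \<Sum>p\<le>N. w a p) = (\<Sum>p\<le>N. v p)"
    proof -
      have "(\<Sum>a\<in>?B. \<Sum>p\<le>N. w a p) = (\<Sum>a\<in>A. \<Sum>p\<le>N. w a p)"
        using assms(1) by (intro sum.mono_neutral_left) (auto intro!: sum.neutral supp)
      also have "\<dots> = (\<Sum>p\<le>N. v p)"
        using w by (subst sum.swap) (simp add: Inv_def)
      finally show ?thesis .
    qed
    have avail: "v (Suc N) \<le> sum ?r ?B"
      using dom[OF Suc.prems] used by (simp add: sum_subtractf)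
    have r: "0 \<le> ?r a" if "a \<in> ?B" for a using w that by (simp add: Inv_def)
    obtain g where g: "fills L ?B ?r g" "sum g ?B = v (Suc N)"
        "v (Suc N) \<in> \<int> \<longrightarrow> (\<forall>a\<in>?B. ?r a \<in> \<int>) \<longrightarrow> (\<forall>a\<in>?B. g a \<in> \<int>)"
      using fills_exists[OF B r v(1) avail] by blast
    define w' where "w' a p = (if p = Suc N then if e a < Suc N then g a else 0 else w a p)" for a p
    have sum': "(\<Sum>q\<le>p. w' a q) = (\<Sum>q\<le>p. w a q)" if "p \<le> N" for a p
      using that by (intro sum.cong) (auto simp: w'_def)
    have "\<forall>a\<in>A. \<forall>p. 0 \<le> w' a p"
      using nonneg g(1) by (auto simp: w'_def fills_def)
    moreover have "\<forall>a\<in>A. \<forall>p. 0 < w' a p \<longrightarrow> e a < p \<and> p \<le> Suc N"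
    proof (intro ballI allI impI)
      fix a p assume ap: "a \<in> A" "0 < w' a p"
      show "e a < p \<and> p \<le> Suc N"
      proof (cases "p = Suc N")
        case False
        then have "0 < w a p" using ap by (simp add: w'_def)
        then show ?thesis using supp[OF ap(1), of p]
          by (cases "e a < p \<and> p \<le> N") auto
      qed (use ap in \<open>auto simp: w'_def split: if_splits\<close>)
    qed
    moreover have "\<forall>p\<le>Suc N. (\<Sum>a\<in>A. w' a p) = v p"
    proof (intro allI impI)
      fix p assume "p \<le> Suc N"
      have "(\<Sum>a\<in>A. if e a < Suc N then g a else 0) = sum g ?B"
        using assms(1) by (simp add: sum.If_cases Int_def)
      then have "(\<Sum>a\<in>A. w' a (Suc N)) = v (Suc N)"
        using g(2) by (simp add: w'_def)
      moreover have "(\<Sum>a\<in>A. w' a p) = v p" if "p \<le> N"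
        using w that by (simp add: Inv_def w'_def)
      ultimately show "(\<Sum>a\<in>A. w' a p) = v p"
        using \<open>p \<le> Suc N\<close> le_Suc_eq by blast
    qed
    moreover have "\<forall>a\<in>A. (\<Sum>p\<le>Suc N. w' a p) \<le> u a"
    proof
      fix a assume a: "a \<in> A"
      have "(\<Sum>p\<le>N. w a p) \<le> u a" using w a by (simp add: Inv_def)
      then show "(\<Sum>p\<le>Suc N. w' a p) \<le> u a"
        using g(1) a by (auto simp: sum' w'_def fills_def)
    qed
    moreover have "\<forall>a\<in>A. \<forall>b\<in>A. \<forall>p. L b a \<and> e b < p \<and> 0 < w' a p \<longrightarrow> (\<Sum>q\<le>p. w' b q) = u b"
    proof (intro ballI allI impI, elim conjE)
      fix a b p assume ab: "a \<in> A" "b \<in> A" "L b a" "e b < p" "0 < w' a p"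
      show "(\<Sum>q\<le>p. w' b q) = u b"
      proof (cases "p = Suc N")
        case True
        then show ?thesis using ab g(1) by (auto simp: sum' w'_def fills_def split: if_splits)
      next
        case False
        then have "p \<le> N" using ab supp[of a p] by (auto simp: w'_def)
        moreover have "(\<Sum>q\<le>p. w b q) = u b"
          using w ab False unfolding Inv_def w'_def by auto
        ultimately show ?thesis by (simp add: sum')
      qed
    qed
    moreover have "(\<forall>a\<in>A. u a \<in> \<int>) \<longrightarrow> (\<forall>p. v p \<in> \<int>) \<longrightarrow> (\<forall>a\<in>A. \<forall>p. w' a p \<in> \<int>)"
      using w g(3) by (auto simp: Inv_def w'_def intro!: Ints_diff Ints_sum)
    ultimately have "Inv (Suc N) w'" unfolding Inv_def by blast
    then show ?case by blast
  qed
  then obtain w where w: "Inv n w" by blast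
  \<comment> \<open>No row exceeds its supply and the totals agree, so every row is used up.\<close>
  have rows: "(\<Sum>p\<le>n. w a p) = u a" if "a \<in> A" for a
  proof -
    have "(\<Sum>a\<in>A. \<Sum>p\<le>n. w a p) = (\<Sum>p\<le>n. v p)"
      using w by (subst sum.swap) (simp add: Inv_def)
    then have "sum (\<lambda>a. u a - (\<Sum>p\<le>n. w a p)) A = 0"
      using total by (simp add: sum_subtractf)
    then show ?thesis
      using w that assms(1) by (subst (asm) sum_nonneg_eq_0_iff) (auto simp: Inv_def)
  qed
  \<comment> \<open>A row that is full at column \<open>p\<close> would overflow if it were used
    again at \<open>q\<close>.\<close>
  have "\<not> (0 < w a p \<and> 0 < w b q)" if "a \<in> A" "b \<in> A" "L b a" "e b < p" "p < q" for a b p q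
  proof
    assume pos: "0 < w a p \<and> 0 < w b q"
    then have "q \<le> n" using w that by (auto simp: Inv_def)
    have "u b + w b q = (\<Sum>r\<in>insert q {..p}. w b r)"
      using w that pos by (simp add: Inv_def)
    also have "\<dots> \<le> (\<Sum>r\<le>n. w b r)"
      using w that \<open>q \<le> n\<close> by (intro sum_mono2) (auto simp: Inv_def)
    finally show False using rows[OF that(2)] pos by simp
  qed
  then have "greedy_coupling L A e n w"
    using w unfolding greedy_coupling_def Inv_def by blast
  then show ?thesis using w rows by (auto simp: Inv_def)
qed

subsection \<open>Weights on vectors, one position at a time\<close>

text \<open>The default \<open>0\<close> lets every positive entry be appended to the empty vector,
  so the first position follows the general rule.\<close>

definition top_entry :: "nat list \<Rightarrow> nat" where
  "top_entry I = (if I = [] then 0 else last I)"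

section \<open>Building \<open>V k n\<close> by appending a last entry\<close>

lemma finite_V: "finite (V k n)"
  by (rule finite_subset[OF _ finite_lists_length_eq[of "{1..n}" k]]) (auto simp: V_def)

lemma V_0: "V 0 n = {[]}"
  by (auto simp: V_def)

lemma snoc_mem_V: "I @ [p] \<in> V (Suc k) n \<longleftrightarrow> I \<in> V k n \<and> top_entry I < p \<and> p \<le> n"
proof -
  have *: "(\<forall>x\<in>set I. x < p) \<longleftrightarrow> (I \<noteq> [] \<longrightarrow> last I < p)" if "sorted_wrt (<) I"
    using that by (induction I rule: rev_induct) (auto simp: sorted_wrt_append)
  show ?thesis
  proof (cases "sorted_wrt (<) I")
    case True
    then show ?thesis by (simp add: V_def top_entry_def sorted_wrt_append *[OF True]) auto
  qed (simp add: V_def sorted_wrt_append)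
qed

lemma V_Suc_snoc:
  assumes "J \<in> V (Suc k) n"
  obtains I p where "J = I @ [p]"
proof -
  have "J \<noteq> []" using assms by (auto simp: V_def)
  then show ?thesis using that by (meson rev_exhaust)
qed

lemma V_Suc: "V (Suc k) n = (\<lambda>(I, p). I @ [p]) ` (SIGMA I:V k n. {top_entry I<..n})"
proof (intro equalityI subsetI)
  fix J assume J: "J \<in> V (Suc k) n"
  then obtain I p where "J = I @ [p]" by (rule V_Suc_snoc)
  then show "J \<in> (\<lambda>(I, p). I @ [p]) ` (SIGMA I:V k n. {top_entry I<..n})"
    using J by (auto simp: snoc_mem_V image_iff)
qed (auto simp: snoc_mem_V)

lemma sum_V_Suc:
  fixes g :: "nat list \<Rightarrow> real"
  shows "sum g (V (Suc k) n) = (\<Sum>I\<in>V k n. \<Sum>p\<in>{top_entry I<..n}. g (I @ [p]))"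
proof -
  have "inj_on (\<lambda>(I, p). I @ [p]) (SIGMA I:V k n. {top_entry I<..n})"
    by (auto simp: inj_on_def)
  then show ?thesis
    by (simp add: V_Suc sum.reindex sum.Sigma finite_V case_prod_unfold)
qed

lemma length_V: "I \<in> V k n \<Longrightarrow> length I = k"
  by (simp add: V_def)

lemma ent_snoc: "I \<in> V k n \<Longrightarrow> 1 \<le> a \<Longrightarrow> a \<le> k \<Longrightarrow> ent (I @ [p]) a = ent I a"
  by (auto simp: ent_def nth_append dest: length_V)

lemma ent_snoc_last: "I \<in> V k n \<Longrightarrow> ent (I @ [p]) (Suc k) = p"
  by (auto simp: ent_def nth_append dest: length_V)

lemma top_entry_eq_ent: "I \<in> V (Suc k) n \<Longrightarrow> top_entry I = ent I (Suc k)"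
  by (auto simp: top_entry_def ent_def last_conv_nth dest: length_V)

text \<open>The distribution function of entry \<open>a\<close>. For \<open>(a, b)\<close> in
  \<open>Pkn k n\<close>, its value at \<open>x = a + b - 1\<close> is the coordinate
  \<open>(a, b)\<close> of the combination of the \<open>chi k n I\<close> with coefficients
  \<open>c\<close>.\<close>

definition cum :: "nat \<Rightarrow> nat \<Rightarrow> (nat list \<Rightarrow> real) \<Rightarrow> nat \<Rightarrow> nat \<Rightarrow> real" where
  "cum n k c a x = (\<Sum>I\<in>V k n. if ent I a \<le> x then c I else 0)"

definition trunc :: "nat \<Rightarrow> (nat list \<Rightarrow> real) \<Rightarrow> nat list \<Rightarrow> real" where
  "trunc n c I = (\<Sum>p\<in>{top_entry I<..n}. c (I @ [p]))"

text \<open>A weight on longer vectors read as a matrix, with truncated vectors as rows and the last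
  entry as column. Its row sums are the marginal \<open>trunc n c\<close>.\<close>

definition ext :: "nat \<Rightarrow> (nat list \<Rightarrow> real) \<Rightarrow> nat list \<Rightarrow> nat \<Rightarrow> real" where
  "ext n c I p = (if top_entry I < p \<and> p \<le> n then c (I @ [p]) else 0)"

lemma sum_trunc: "sum (trunc n c) (V k n) = sum c (V (Suc k) n)"
  by (simp add: sum_V_Suc trunc_def)

lemma sum_ext: "(\<Sum>p\<le>n. ext n c I p) = trunc n c I"
  unfolding trunc_def ext_def by (rule sum.mono_neutral_cong_right) auto

lemma cum_trunc:
  assumes "1 \<le> a" "a \<le> k"
  shows "cum n (Suc k) c a x = cum n k (trunc n c) a x"
  unfolding cum_def sum_V_Suc by (rule sum.cong) (auto simp: ent_snoc[OF _ assms] trunc_def)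

lemma cum_last: "cum n (Suc k) c (Suc k) x = (\<Sum>p\<le>x. \<Sum>I\<in>V k n. ext n c I p)"
proof -
  have "cum n (Suc k) c (Suc k) x = (\<Sum>I\<in>V k n. \<Sum>p\<le>x. ext n c I p)"
    unfolding cum_def sum_V_Suc
  proof (rule sum.cong[OF refl])
    fix I assume I: "I \<in> V k n"
    have "(\<Sum>p\<in>{top_entry I<..n}. if ent (I @ [p]) (Suc k) \<le> x then c (I @ [p]) else 0)
        = (\<Sum>p\<in>{top_entry I<..n} \<inter> {..x}. c (I @ [p]))"
      using I by (subst sum.inter_restrict) (auto simp: ent_snoc_last)
    also have "\<dots> = (\<Sum>p\<le>x. ext n c I p)"
      by (rule sum.mono_neutral_cong_left) (auto simp: ext_def)
    finally show "(\<Sum>p\<in>{top_entry I<..n}. if ent (I @ [p]) (Suc k) \<le> x then c (I @ [p]) else 0)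
        = (\<Sum>p\<le>x. ext n c I p)" .
  qed
  also have "\<dots> = (\<Sum>p\<le>x. \<Sum>I\<in>V k n. ext n c I p)" by (rule sum.swap)
  finally show ?thesis .
qed

text \<open>\<open>L J I\<close> means that \<open>J\<close> has priority over \<open>I\<close>.
  \<open>R_snoc\<close> lists the inversions of a greedy coupling twice, with the roles of the two
  vectors exchanged. \<open>k\<close> is universally quantified, so a single \<open>L\<close> orders
  the vectors of every length.\<close>

locale greedy_relation =
  fixes n :: nat and R :: "nat \<Rightarrow> nat list \<Rightarrow> nat list \<Rightarrow> bool"
    and L :: "nat list \<Rightarrow> nat list \<Rightarrow> bool"
  assumes R_Nil: "R 0 [] []"
    and L_order: "asymp_on (V k n) L" "transp_on (V k n) L" "totalp_on (V k n) L"
    and R_snoc: "I @ [p] \<in> V (Suc k) n \<Longrightarrow> J @ [q] \<in> V (Suc k) n \<Longrightarrow>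
      R (Suc k) (I @ [p]) (J @ [q]) \<longleftrightarrow>
        R k I J \<and> \<not> (L J I \<and> top_entry J < p \<and> p < q) \<and> \<not> (L I J \<and> top_entry I < q \<and> q < p)"
begin

definition weighting :: "nat \<Rightarrow> (nat list \<Rightarrow> real) \<Rightarrow> bool" where
  "weighting k c \<longleftrightarrow> (\<forall>I\<in>V k n. 0 \<le> c I) \<and>
     (\<forall>I\<in>V k n. \<forall>J\<in>V k n. 0 < c I \<and> 0 < c J \<longrightarrow> R k I J)"

lemma weighting_cong: "(\<And>I. I \<in> V k n \<Longrightarrow> c I = d I) \<Longrightarrow> weighting k c \<longleftrightarrow> weighting k d"
  by (auto simp: weighting_def)

text \<open>The bridge from pairwise relations to couplings: two vectors are related iff their
  truncations are and the last entries form no inversion, and a truncation has positive weight iff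
  one of its extensions does.\<close>

lemma weighting_Suc:
  "weighting (Suc k) c \<longleftrightarrow>
     weighting k (trunc n c) \<and> greedy_coupling L (V k n) top_entry n (ext n c)"
proof
  assume c: "weighting (Suc k) c"
  have nonneg: "0 \<le> c (I @ [p])" if "I \<in> V k n" "p \<in> {top_entry I<..n}" for I p
    using c that by (auto simp: weighting_def snoc_mem_V)
  have pos: "\<exists>p\<in>{top_entry I<..n}. 0 < c (I @ [p])" if "0 < trunc n c I" for I
    using that sum_nonpos[of "{top_entry I<..n}" "\<lambda>p. c (I @ [p])"]
    by (fastforce simp: trunc_def not_less)
  have "R k I J" if IJ: "I \<in> V k n" "J \<in> V k n" and tr: "0 < trunc n c I" "0 < trunc n c J" for I J
  proof -
    obtain p q where pq: "p \<in> {top_entry I<..n}" "0 < c (I @ [p])"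
        "q \<in> {top_entry J<..n}" "0 < c (J @ [q])"
      using pos[OF tr(1)] pos[OF tr(2)] by blast
    then have mem: "I @ [p] \<in> V (Suc k) n" "J @ [q] \<in> V (Suc k) n"
      using IJ by (auto simp: snoc_mem_V)
    then have "R (Suc k) (I @ [p]) (J @ [q])" using c pq by (simp add: weighting_def)
    then show "R k I J" using R_snoc[OF mem] by simp
  qed
  moreover have "0 \<le> trunc n c I" if "I \<in> V k n" for I
    using nonneg[OF that] by (auto simp: trunc_def intro: sum_nonneg)
  moreover have "\<not> (0 < ext n c I p \<and> 0 < ext n c J q)"
    if "I \<in> V k n" "J \<in> V k n" "L J I" "top_entry J < p" "p < q" for I J p q
  proof
    assume *: "0 < ext n c I p \<and> 0 < ext n c J q"
    then have mem: "I @ [p] \<in> V (Suc k) n" "J @ [q] \<in> V (Suc k) n"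
      using that by (auto simp: snoc_mem_V ext_def split: if_splits)
    then have "R (Suc k) (I @ [p]) (J @ [q])"
      using c * by (auto simp: weighting_def ext_def split: if_splits)
    then show False using R_snoc[OF mem] that by simp
  qed
  moreover have "0 \<le> ext n c I p" "0 < ext n c I p \<longrightarrow> top_entry I < p \<and> p \<le> n"
    if "I \<in> V k n" for I p
    using nonneg[OF that] by (auto simp: ext_def)
  ultimately show "weighting k (trunc n c) \<and> greedy_coupling L (V k n) top_entry n (ext n c)"
    unfolding weighting_def greedy_coupling_def by blast
next
  assume *: "weighting k (trunc n c) \<and> greedy_coupling L (V k n) top_entry n (ext n c)"
  have ext: "ext n c I p = c (I @ [p])" if "I @ [p] \<in> V (Suc k) n" for I p
    using that by (auto simp: ext_def snoc_mem_V)
  have nonneg: "0 \<le> c (I @ [p])" if "I @ [p] \<in> V (Suc k) n" for I p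
    using * that unfolding ext[OF that, symmetric] by (auto simp: greedy_coupling_def snoc_mem_V)
  have pos: "0 < trunc n c I" if "I @ [p] \<in> V (Suc k) n" "0 < c (I @ [p])" for I p
    unfolding trunc_def using that nonneg by (intro sum_pos2[of _ p]) (auto simp: snoc_mem_V)
  have "R (Suc k) (I @ [p]) (J @ [q])"
    if mem: "I @ [p] \<in> V (Suc k) n" "J @ [q] \<in> V (Suc k) n"
      and cp: "0 < c (I @ [p])" "0 < c (J @ [q])" for I J p q
    unfolding R_snoc[OF mem]
  proof (intro conjI)
    have IJ: "I \<in> V k n" "J \<in> V k n" using mem by (auto simp: snoc_mem_V)
    show "R k I J" using * IJ pos[OF mem(1) cp(1)] pos[OF mem(2) cp(2)] by (auto simp: weighting_def)
    have "0 < ext n c I p" "0 < ext n c J q" using ext mem cp by auto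
    then show "\<not> (L J I \<and> top_entry J < p \<and> p < q)" "\<not> (L I J \<and> top_entry I < q \<and> q < p)"
      using * IJ unfolding greedy_coupling_def by blast+
  qed
  then show "weighting (Suc k) c"
    using nonneg V_Suc_snoc unfolding weighting_def by metis
qed

text \<open>By induction the first \<open>k\<close> positions determine the truncated weight, that
  is the row sums; the last position determines the column sums; together these determine a greedy
  coupling.\<close>

lemma weighting_unique:
  assumes "weighting k c" "weighting k d" "sum c (V k n) = sum d (V k n)"
    and "\<And>a x. 1 \<le> a \<Longrightarrow> a \<le> k \<Longrightarrow> cum n k c a x = cum n k d a x"
    and "I \<in> V k n"
  shows "c I = d I"
  using assms
proof (induction k arbitrary: c d I)
  case 0
  then show ?case by (simp add: V_0)
next
  case (Suc k)
  note c = Suc.prems(1)[unfolded weighting_Suc] and d = Suc.prems(2)[unfolded weighting_Suc]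
  have rows: "trunc n c J = trunc n d J" if "J \<in> V k n" for J
  proof (rule Suc.IH[OF _ _ _ _ that])
    fix a x :: nat assume "1 \<le> a" "a \<le> k"
    then show "cum n k (trunc n c) a x = cum n k (trunc n d) a x"
      using Suc.prems(4)[of a x] by (simp add: cum_trunc)
  qed (use c d Suc.prems(3) in \<open>simp_all add: sum_trunc\<close>)
  have cums: "(\<Sum>p\<le>x. \<Sum>J\<in>V k n. ext n c J p) = (\<Sum>p\<le>x. \<Sum>J\<in>V k n. ext n d J p)" for x
    using Suc.prems(4)[of "Suc k" x] by (simp add: cum_last)
  \<comment> \<open>A column sum is the difference of two consecutive values of the distribution
    function.\<close>
  have cols: "(\<Sum>J\<in>V k n. ext n c J p) = (\<Sum>J\<in>V k n. ext n d J p)" for p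
    using cums[of p] cums[of "p - 1"] by (cases p) auto
  obtain J p where I: "I = J @ [p]" "J \<in> V k n" "top_entry J < p" "p \<le> n"
    using Suc.prems(5) by (auto simp: V_Suc)
  have "ext n c J p = ext n d J p"
  proof (rule greedy_coupling_unique[OF finite_V L_order(3), where w = "ext n c" and w' = "ext n d"])
    show "(\<Sum>p\<le>n. ext n c J p) = (\<Sum>p\<le>n. ext n d J p)" if "J \<in> V k n" for J
      using rows[OF that] by (simp add: sum_ext)
  qed (use c d I(2) cols in auto)
  then show ?case using I by (simp add: ext_def)
qed

text \<open>\<open>F a\<close> is the prescribed distribution function of entry \<open>a\<close>,
  with row \<open>0\<close> as a constant boundary value. The diagonal inequality between
  consecutive rows becomes the domination condition of the next coupling.\<close>

lemma weighting_exists: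
  fixes F :: "nat \<Rightarrow> nat \<Rightarrow> real"
  assumes "0 \<le> T" and "\<And>p. F 0 p = T"
    and "\<And>a p. a < k \<Longrightarrow> F (Suc a) (Suc p) \<le> F a p"
    and "\<And>a p. a < k \<Longrightarrow> F (Suc a) p \<le> F (Suc a) (Suc p)"
    and "\<And>a. a < k \<Longrightarrow> F (Suc a) 0 = 0" and "\<And>a. a < k \<Longrightarrow> F (Suc a) n = T"
  shows "\<exists>c. weighting k c \<and> sum c (V k n) = T \<and>
           (\<forall>a x. 1 \<le> a \<and> a \<le> k \<and> x \<le> n \<longrightarrow> cum n k c a x = F a x) \<and>
           ((\<forall>a p. F a p \<in> \<int>) \<longrightarrow> (\<forall>I\<in>V k n. c I \<in> \<int>))"
  using assms
proof (induction k)
  case 0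
  have "weighting 0 (\<lambda>_. T)" using 0 R_Nil by (simp add: weighting_def V_0)
  moreover have "(\<forall>a p. F a p \<in> \<int>) \<longrightarrow> T \<in> \<int>" using 0(2)[of 0] by metis
  ultimately show ?case by (intro exI[of _ "\<lambda>_. T"]) (auto simp: V_0)
next
  case (Suc k)
  have "\<exists>c. weighting k c \<and> sum c (V k n) = T \<and>
           (\<forall>a x. 1 \<le> a \<and> a \<le> k \<and> x \<le> n \<longrightarrow> cum n k c a x = F a x) \<and>
           ((\<forall>a p. F a p \<in> \<int>) \<longrightarrow> (\<forall>I\<in>V k n. c I \<in> \<int>))"
    by (rule Suc.IH) (use Suc.prems in auto)
  then obtain c where c: "weighting k c" "sum c (V k n) = T"
      "\<forall>a x. 1 \<le> a \<and> a \<le> k \<and> x \<le> n \<longrightarrow> cum n k c a x = F a x"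
      "(\<forall>a p. F a p \<in> \<int>) \<longrightarrow> (\<forall>I\<in>V k n. c I \<in> \<int>)"
    by blast
  define v where "v p = (case p of 0 \<Rightarrow> 0 | Suc q \<Rightarrow> F (Suc k) (Suc q) - F (Suc k) q)" for p
  have sum_v: "(\<Sum>q\<le>p. v q) = F (Suc k) p" for p
    using Suc.prems(5)[of k] by (induction p) (auto simp: v_def)
  have nonneg: "0 \<le> c I" if "I \<in> V k n" for I using c(1) that by (simp add: weighting_def)
  \<comment> \<open>The rows available at \<open>p = Suc q\<close> are the vectors with top entry at
    most \<open>q\<close>. Their weight is \<open>F k q\<close>, also for \<open>k = 0\<close>,
    where \<open>F 0 q = T\<close>.\<close>
  have dom: "F (Suc k) p \<le> (\<Sum>I\<in>{I\<in>V k n. top_entry I < p}. c I)" if "p \<le> n" for p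
  proof (cases p)
    case 0
    then show ?thesis using Suc.prems(5)[of k] by simp
  next
    case (Suc q)
    have "(\<Sum>I\<in>{I\<in>V k n. top_entry I < p}. c I) = F k q"
    proof (cases k)
      case 0
      then show ?thesis using c(2) Suc.prems(2) \<open>p = Suc q\<close>
        by (simp add: V_0 top_entry_def cong: conj_cong)
    next
      case (Suc k')
      have "(\<Sum>I\<in>{I\<in>V k n. top_entry I < p}. c I) = cum n k c k q"
        using \<open>p = Suc q\<close> Suc finite_V
        by (simp add: cum_def sum.inter_filter[symmetric] top_entry_eq_ent less_Suc_eq_le cong: conj_cong)
      then show ?thesis using c(3) \<open>p = Suc q\<close> Suc that by simp
    qed
    then show ?thesis using Suc.prems(3)[of k q] Suc by simp
  qed
  have v0: "0 \<le> v p" for p using Suc.prems(4)[of k] by (auto simp: v_def split: nat.split)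
  have "\<exists>w. greedy_coupling L (V k n) top_entry n w \<and> (\<forall>I\<in>V k n. (\<Sum>p\<le>n. w I p) = c I) \<and>
      (\<forall>p\<le>n. (\<Sum>I\<in>V k n. w I p) = v p) \<and>
      ((\<forall>I\<in>V k n. c I \<in> \<int>) \<longrightarrow> (\<forall>p. v p \<in> \<int>) \<longrightarrow> (\<forall>I\<in>V k n. \<forall>p. w I p \<in> \<int>))"
    by (rule greedy_coupling_exists[OF finite_V L_order])
      (use nonneg v0 dom Suc.prems(6)[of k] c(2) in \<open>auto simp: sum_v v_def[of 0]\<close>)
  then obtain w where w: "greedy_coupling L (V k n) top_entry n w"
      "\<forall>I\<in>V k n. (\<Sum>p\<le>n. w I p) = c I" "\<forall>p\<le>n. (\<Sum>I\<in>V k n. w I p) = v p"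
      "(\<forall>I\<in>V k n. c I \<in> \<int>) \<longrightarrow> (\<forall>p. v p \<in> \<int>) \<longrightarrow> (\<forall>I\<in>V k n. \<forall>p. w I p \<in> \<int>)"
    by blast
  define d where "d J = w (butlast J) (last J)" for J
  \<comment> \<open>This holds even where no entry can be appended, since \<open>w\<close> vanishes
    there.\<close>
  have ext_d: "ext n d I p = w I p" if "I \<in> V k n" for I p
    using greedy_couplingD(2)[OF w(1) that, of p] by (auto simp: ext_def d_def)
  have trunc_d: "trunc n d I = c I" if "I \<in> V k n" for I
    using w(2) that by (simp add: sum_ext[symmetric] ext_d[OF that])
  have "weighting (Suc k) d"
    unfolding weighting_Suc
  proof
    show "weighting k (trunc n d)" using c(1) weighting_cong[of k "trunc n d" c] trunc_d by blast
    show "greedy_coupling L (V k n) top_entry n (ext n d)"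
      using w(1) greedy_coupling_cong[of "V k n" "ext n d" w] ext_d by blast
  qed
  moreover have "sum d (V (Suc k) n) = T"
    using c(2) by (simp add: sum_trunc[symmetric] trunc_d)
  moreover have "cum n (Suc k) d a x = F a x" if "1 \<le> a" "a \<le> Suc k" "x \<le> n" for a x
  proof (cases "a = Suc k")
    case True
    then show ?thesis using w(3) that by (simp add: cum_last ext_d sum_v)
  next
    case False
    then have "cum n (Suc k) d a x = cum n k (trunc n d) a x" using that by (simp add: cum_trunc)
    also have "\<dots> = cum n k c a x"
      unfolding cum_def by (rule sum.cong) (simp_all add: trunc_d)
    finally show ?thesis using c(3) that False by simp
  qed
  moreover have "d J \<in> \<int>" if "\<forall>a p. F a p \<in> \<int>" "J \<in> V (Suc k) n" for J
  proof -
    have "\<forall>p. v p \<in> \<int>" using that(1) by (auto simp: v_def split: nat.split)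
    then show ?thesis using w(4) c(4) that by (auto simp: d_def V_Suc)
  qed
  ultimately show ?case by blast
qed

end

subsection \<open>Triangulations from unique integral representations\<close>

text \<open>\<open>unique\<close> concerns real weights and yields the geometry.
  \<open>straighten\<close> replaces a multiset of vertices by one of the same size and sum that is
  supported on a face; it serves unimodularity.\<close>

locale straightening =
  fixes Vs :: "'v set" and X :: "'v \<Rightarrow> 'b::real_vector" and C :: "'v \<Rightarrow> 'v \<Rightarrow> bool"
  assumes fin: "finite Vs"
    and C_refl: "I \<in> Vs \<Longrightarrow> C I I"
    and unique: "\<lbrakk>\<forall>I\<in>Vs. 0 \<le> c I; \<forall>I\<in>Vs. \<forall>J\<in>Vs. 0 < c I \<and> 0 < c J \<longrightarrow> C I J;
        \<forall>I\<in>Vs. 0 \<le> d I; \<forall>I\<in>Vs. \<forall>J\<in>Vs. 0 < d I \<and> 0 < d J \<longrightarrow> C I J;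
        sum c Vs = sum d Vs; (\<Sum>I\<in>Vs. c I *\<^sub>R X I) = (\<Sum>I\<in>Vs. d I *\<^sub>R X I); I \<in> Vs\<rbrakk>
      \<Longrightarrow> c I = d I"
    and straighten: "\<exists>c. (\<forall>I\<in>Vs. c I \<in> \<int> \<and> 0 \<le> c I) \<and>
        (\<forall>I\<in>Vs. \<forall>J\<in>Vs. 0 < c I \<and> 0 < c J \<longrightarrow> C I J) \<and>
        sum c Vs = (\<Sum>I\<in>Vs. real (f I)) \<and>
        (\<Sum>I\<in>Vs. c I *\<^sub>R X I) = (\<Sum>I\<in>Vs. real (f I) *\<^sub>R X I)"
begin

section \<open>Faces, barycentric coordinates and intersections of simplices\<close>

definition \<Delta> :: "'v set set" where
  "\<Delta> = {\<sigma>. \<sigma> \<subseteq> Vs \<and> (\<forall>I\<in>\<sigma>. \<forall>J\<in>\<sigma>. C I J)}"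

lemma unique_on_face:
  assumes "\<sigma> \<in> \<Delta>" "\<tau> \<in> \<Delta>" "\<And>I. I \<in> Vs \<Longrightarrow> 0 \<le> c I" "\<And>I. I \<in> Vs \<Longrightarrow> 0 \<le> d I"
    and "\<And>I. I \<in> Vs \<Longrightarrow> I \<notin> \<sigma> \<Longrightarrow> c I = 0" "\<And>I. I \<in> Vs \<Longrightarrow> I \<notin> \<tau> \<Longrightarrow> d I = 0"
    and "sum c Vs = sum d Vs" "(\<Sum>I\<in>Vs. c I *\<^sub>R X I) = (\<Sum>I\<in>Vs. d I *\<^sub>R X I)" "I \<in> Vs"
  shows "c I = d I"
proof (rule unique[OF _ _ _ _ assms(7-9)])
  show "\<forall>I\<in>Vs. \<forall>J\<in>Vs. 0 < c I \<and> 0 < c J \<longrightarrow> C I J"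
    using assms(1,5) unfolding \<Delta>_def by (metis (no_types, lifting) less_irrefl mem_Collect_eq)
  show "\<forall>I\<in>Vs. \<forall>J\<in>Vs. 0 < d I \<and> 0 < d J \<longrightarrow> C I J"
    using assms(2,6) unfolding \<Delta>_def by (metis (no_types, lifting) less_irrefl mem_Collect_eq)
qed (use assms in auto)

lemma \<Delta>_subset: "\<sigma> \<in> \<Delta> \<Longrightarrow> \<sigma> \<subseteq> Vs" "\<sigma> \<in> \<Delta> \<Longrightarrow> finite \<sigma>"
  using fin by (auto simp: \<Delta>_def intro: finite_subset)

lemma singleton_face: "I \<in> Vs \<Longrightarrow> {I} \<in> \<Delta>"
  by (simp add: \<Delta>_def C_refl)

lemma sum_face:
  fixes g :: "'v \<Rightarrow> 'c::comm_monoid_add"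
  assumes "\<sigma> \<subseteq> Vs"
  shows "(\<Sum>I\<in>Vs. if I \<in> \<sigma> then g I else 0) = sum g \<sigma>"
  using assms fin by (simp add: sum.If_cases Int_absorb1)

lemma sum_face_scaleR:
  assumes "\<sigma> \<subseteq> Vs"
  shows "(\<Sum>I\<in>Vs. (if I \<in> \<sigma> then u I else 0) *\<^sub>R X I) = (\<Sum>I\<in>\<sigma>. u I *\<^sub>R X I)"
  by (simp add: sum_face[OF assms, symmetric] if_distrib[of "\<lambda>t. t *\<^sub>R _"] cong: if_cong)

text \<open>Weight \<open>1\<close> at \<open>I\<close> and weight \<open>1\<close> at
  \<open>J\<close> would represent the same point.\<close>

lemma inj_X: "inj_on X Vs"
proof (rule inj_onI)
  fix I J assume IJ: "I \<in> Vs" "J \<in> Vs" "X I = X J"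
  define ind :: "'v \<Rightarrow> 'v \<Rightarrow> real" where "ind K H = (if H \<in> {K} then 1 else 0)" for K H
  have sums: "sum (ind K) Vs = 1" "(\<Sum>H\<in>Vs. ind K H *\<^sub>R X H) = X K" if "K \<in> Vs" for K
    using that sum_face[of "{K}" "\<lambda>_. 1::real"] sum_face_scaleR[of "{K}" "\<lambda>_. 1"]
    by (simp_all add: ind_def)
  have "ind I I = ind J I"
    by (rule unique_on_face[OF singleton_face[OF IJ(1)] singleton_face[OF IJ(2)]])
      (use IJ in \<open>simp_all only: sums\<close>, use IJ in \<open>auto simp: ind_def\<close>)
  then show "I = J" by (auto simp: ind_def split: if_splits)
qed

text \<open>The positive and the negative part of an affine dependence are nonnegative weights on
  one face with equal total and equal sum, so they coincide.\<close>

lemma affine_independent_face: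
  assumes "\<sigma> \<in> \<Delta>"
  shows "\<not> affine_dependent (X ` \<sigma>)"
proof
  note sub = \<Delta>_subset[OF assms]
  have inj: "inj_on X \<sigma>" using inj_X sub(1) by (rule inj_on_subset)
  assume "affine_dependent (X ` \<sigma>)"
  then obtain u where u: "sum u (X ` \<sigma>) = 0" "\<exists>v\<in>X ` \<sigma>. u v \<noteq> 0" "(\<Sum>v\<in>X ` \<sigma>. u v *\<^sub>R v) = 0"
    using sub(2) by (auto simp: affine_dependent_explicit_finite)
  define w where "w I = (if I \<in> \<sigma> then u (X I) else 0)" for I
  have w: "sum w Vs = 0" "(\<Sum>I\<in>Vs. w I *\<^sub>R X I) = 0"
    using u(1,3) inj by (simp_all add: w_def sum_face[OF sub(1)] sum_face_scaleR[OF sub(1)] sum.reindex)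
  have split: "max (w I) 0 = w I + max (- w I) 0" for I by auto
  have "max (w I) 0 = max (- w I) 0" if "I \<in> Vs" for I
  proof (rule unique_on_face[OF assms assms _ _ _ _ _ _ that])
    show "(\<Sum>I\<in>Vs. max (w I) 0) = (\<Sum>I\<in>Vs. max (- w I) 0)"
      using w(1) by (subst split) (simp add: sum.distrib)
    show "(\<Sum>I\<in>Vs. max (w I) 0 *\<^sub>R X I) = (\<Sum>I\<in>Vs. max (- w I) 0 *\<^sub>R X I)"
      using w(2) by (subst split) (simp add: sum.distrib scaleR_add_left)
  qed (auto simp: w_def)
  then have "w I = 0" if "I \<in> Vs" for I using that by (metis split add_0 add_right_cancel)
  then have "u (X I) = 0" if "I \<in> \<sigma>" for I
    using that sub(1) unfolding w_def by (metis subsetD)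
  then show False using u(2) by auto
qed

text \<open>Coefficients are extended by zero to all of \<open>Vs\<close>, so that coordinates on
  different faces can be compared by \<open>unique_on_face\<close>.\<close>

lemma mem_hull_face:
  assumes "\<sigma> \<in> \<Delta>"
  shows "x \<in> convex hull (X ` \<sigma>) \<longleftrightarrow>
    (\<exists>c. (\<forall>I\<in>Vs. 0 \<le> c I) \<and> (\<forall>I\<in>Vs. I \<notin> \<sigma> \<longrightarrow> c I = 0) \<and> sum c Vs = 1 \<and>
         (\<Sum>I\<in>Vs. c I *\<^sub>R X I) = x)"
proof -
  note sub = \<Delta>_subset[OF assms]
  have inj: "inj_on X \<sigma>" using inj_X sub(1) by (rule inj_on_subset)
  show ?thesis
  proof
    assume "x \<in> convex hull (X ` \<sigma>)"
    then obtain u where u: "\<forall>v\<in>X ` \<sigma>. 0 \<le> u v" "sum u (X ` \<sigma>) = 1" "(\<Sum>v\<in>X ` \<sigma>. u v *\<^sub>R v) = x"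
      using sub(2) by (auto simp: convex_hull_finite)
    show "\<exists>c. (\<forall>I\<in>Vs. 0 \<le> c I) \<and> (\<forall>I\<in>Vs. I \<notin> \<sigma> \<longrightarrow> c I = 0) \<and> sum c Vs = 1 \<and>
         (\<Sum>I\<in>Vs. c I *\<^sub>R X I) = x"
      using u inj
      by (intro exI[of _ "\<lambda>I. if I \<in> \<sigma> then u (X I) else 0"])
        (auto simp: sum_face[OF sub(1)] sum_face_scaleR[OF sub(1)] sum.reindex)
  next
    assume "\<exists>c. (\<forall>I\<in>Vs. 0 \<le> c I) \<and> (\<forall>I\<in>Vs. I \<notin> \<sigma> \<longrightarrow> c I = 0) \<and> sum c Vs = 1 \<and>
         (\<Sum>I\<in>Vs. c I *\<^sub>R X I) = x"
    then obtain c where c: "\<forall>I\<in>Vs. 0 \<le> c I" "\<forall>I\<in>Vs. I \<notin> \<sigma> \<longrightarrow> c I = 0" "sum c Vs = 1"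
         "(\<Sum>I\<in>Vs. c I *\<^sub>R X I) = x" by blast
    have restr: "sum c \<sigma> = 1" "(\<Sum>I\<in>\<sigma>. c I *\<^sub>R X I) = x"
      unfolding c(3)[symmetric] c(4)[symmetric]
      using sub fin c(2) by (auto intro!: sum.mono_neutral_left)
    have "(\<Sum>I\<in>\<sigma>. c I *\<^sub>R X I) \<in> convex hull (X ` \<sigma>)"
      using c(1) sub restr(1) by (intro convex_sum) (auto intro: hull_inc)
    then show "x \<in> convex hull (X ` \<sigma>)" using restr(2) by simp
  qed
qed

text \<open>A common point has the same coordinates in both simplices, so they vanish off
  \<open>\<tau>\<close>. Inside a segment they mix those of the end points with positive factors, so
  the coordinates of the end points vanish off \<open>\<tau>\<close> too.\<close>

lemma hull_Int_face_of:
  assumes "\<sigma> \<in> \<Delta>" "\<tau> \<in> \<Delta>"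
  shows "(convex hull (X ` \<sigma>) \<inter> convex hull (X ` \<tau>)) face_of convex hull (X ` \<sigma>)"
  unfolding face_of_def
proof (intro conjI ballI impI)
  show "convex (convex hull (X ` \<sigma>) \<inter> convex hull (X ` \<tau>))"
    by (intro convex_Int convex_convex_hull)
  fix a b x assume a: "a \<in> convex hull (X ` \<sigma>)" and b: "b \<in> convex hull (X ` \<sigma>)"
    and x: "x \<in> convex hull (X ` \<sigma>) \<inter> convex hull (X ` \<tau>)" and seg: "x \<in> open_segment a b"
  obtain c where c: "\<forall>I\<in>Vs. 0 \<le> c I" "\<forall>I\<in>Vs. I \<notin> \<sigma> \<longrightarrow> c I = 0" "sum c Vs = 1"
      "(\<Sum>I\<in>Vs. c I *\<^sub>R X I) = a" using a by (auto simp: mem_hull_face[OF assms(1)])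
  obtain d where d: "\<forall>I\<in>Vs. 0 \<le> d I" "\<forall>I\<in>Vs. I \<notin> \<sigma> \<longrightarrow> d I = 0" "sum d Vs = 1"
      "(\<Sum>I\<in>Vs. d I *\<^sub>R X I) = b" using b by (auto simp: mem_hull_face[OF assms(1)])
  obtain g where g: "\<forall>I\<in>Vs. 0 \<le> g I" "\<forall>I\<in>Vs. I \<notin> \<tau> \<longrightarrow> g I = 0" "sum g Vs = 1"
      "(\<Sum>I\<in>Vs. g I *\<^sub>R X I) = x" using x by (auto simp: mem_hull_face[OF assms(2)])
  obtain t where t: "0 < t" "t < 1" "x = (1 - t) *\<^sub>R a + t *\<^sub>R b"
    using seg by (auto simp: in_segment)
  have eq: "(1 - t) * c I + t * d I = g I" if "I \<in> Vs" for I
  proof (rule unique_on_face[OF assms _ _ _ _ _ _ that])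
    show "(\<Sum>I\<in>Vs. (1 - t) * c I + t * d I) = sum g Vs"
      by (simp add: sum.distrib sum_distrib_left[symmetric] c(3) d(3) g(3))
    show "(\<Sum>I\<in>Vs. ((1 - t) * c I + t * d I) *\<^sub>R X I) = (\<Sum>I\<in>Vs. g I *\<^sub>R X I)"
      unfolding g(4) t(3) c(4)[symmetric] d(4)[symmetric]
      by (simp add: sum.distrib scaleR_add_left scaleR_sum_right)
  qed (use c d g t in auto)
  have zero: "c I = 0 \<and> d I = 0" if "I \<in> Vs" "I \<notin> \<tau>" for I
  proof -
    have "(1 - t) * c I + t * d I = 0" "0 \<le> (1 - t) * c I" "0 \<le> t * d I"
      using eq[OF that(1)] g(2) c(1) d(1) t that by auto
    then have "(1 - t) * c I = 0" "t * d I = 0" by linarith+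
    then show ?thesis using t by simp
  qed
  show "a \<in> convex hull (X ` \<sigma>) \<inter> convex hull (X ` \<tau>)"
    using a zero c by (auto simp: mem_hull_face[OF assms(2)])
  show "b \<in> convex hull (X ` \<sigma>) \<inter> convex hull (X ` \<tau>)"
    using b zero d by (auto simp: mem_hull_face[OF assms(2)])
qed auto

lemma flag: "flag_complex_on Vs \<Delta>"
  unfolding flag_complex_on_def simplicial_complex_on_def
proof (intro conjI)
  show "\<forall>\<sigma>\<in>\<Delta>. \<sigma> \<subseteq> Vs \<and> finite \<sigma>" using \<Delta>_subset by blast
  show "\<forall>\<sigma>\<in>\<Delta>. \<forall>\<tau>. \<tau> \<subseteq> \<sigma> \<longrightarrow> \<tau> \<in> \<Delta>" unfolding \<Delta>_def by blast
  show "\<forall>v\<in>Vs. {v} \<in> \<Delta>" using singleton_face by blast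
  show "\<forall>\<sigma>. finite \<sigma> \<and> \<sigma> \<subseteq> Vs \<and> (\<forall>u\<in>\<sigma>. \<forall>v\<in>\<sigma>. {u, v} \<in> \<Delta>) \<longrightarrow> \<sigma> \<in> \<Delta>"
    unfolding \<Delta>_def by blast
qed

text \<open>It suffices to find \<open>M0\<close> such that \<open>M0\<close> times the vertex sum
  plus \<open>X J\<close> has an integral representation supported exactly on
  \<open>\<sigma>\<close>; it is found among infinitely many \<open>M\<close> with a common
  support.\<close>

lemma maximal_face_integer_affine:
  assumes max: "maximal_face \<Delta> \<sigma>" and J: "J \<in> Vs"
  shows "\<exists>g :: 'v \<Rightarrow> int. sum g \<sigma> = 1 \<and> X J = (\<Sum>I\<in>\<sigma>. of_int (g I) *\<^sub>R X I)"
proof -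
  have \<sigma>: "\<sigma> \<in> \<Delta>" using max by (simp add: maximal_face_def)
  note sub = \<Delta>_subset[OF \<sigma>]
  define one :: "'v \<Rightarrow> real" where "one I = (if I \<in> \<sigma> then 1 else 0)" for I
  define delta :: "'v \<Rightarrow> real" where "delta I = (if I \<in> {J} then 1 else 0)" for I
  define T where "T = sum one Vs"
  define s where "s = (\<Sum>I\<in>Vs. one I *\<^sub>R X I)"
  have delta: "sum delta Vs = 1" "(\<Sum>I\<in>Vs. delta I *\<^sub>R X I) = X J"
    using J sum_face[of "{J}" "\<lambda>_. 1::real"] sum_face_scaleR[of "{J}" "\<lambda>_. 1"]
    by (simp_all add: delta_def)
  have "\<exists>c. (\<forall>I\<in>Vs. c I \<in> \<int> \<and> 0 \<le> c I) \<and>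
        (\<forall>I\<in>Vs. \<forall>J\<in>Vs. 0 < c I \<and> 0 < c J \<longrightarrow> C I J) \<and>
        sum c Vs = real M * T + 1 \<and> (\<Sum>I\<in>Vs. c I *\<^sub>R X I) = real M *\<^sub>R s + X J" for M :: nat
  proof -
    define f where "f I = M * (if I \<in> \<sigma> then 1 else 0) + (if I \<in> {J} then 1 else 0)" for I
    have f: "real (f I) = real M * one I + delta I" for I by (simp add: f_def one_def delta_def)
    have "(\<Sum>I\<in>Vs. real (f I)) = real M * T + 1"
      by (simp add: f sum.distrib sum_distrib_left[symmetric] T_def delta)
    moreover have "(\<Sum>I\<in>Vs. real (f I) *\<^sub>R X I) = real M *\<^sub>R s + X J"
      by (simp add: f sum.distrib scaleR_add_left s_def scaleR_sum_right delta)
    ultimately show ?thesis using straighten[of f] by simp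
  qed
  then obtain c where c: "\<And>M I. I \<in> Vs \<Longrightarrow> c M I \<in> \<int> \<and> 0 \<le> c M I"
      "\<And>M I J. I \<in> Vs \<Longrightarrow> J \<in> Vs \<Longrightarrow> 0 < c M I \<and> 0 < c M J \<Longrightarrow> C I J"
      "\<And>M. sum (c M) Vs = real M * T + 1"
      "\<And>M. (\<Sum>I\<in>Vs. c M I *\<^sub>R X I) = real M *\<^sub>R s + X J"
    by metis
  define supp where "supp M = {I\<in>Vs. 0 < c M I}" for M :: nat
  have supp: "supp M \<in> \<Delta>" for M using c(2) by (auto simp: \<Delta>_def supp_def)
  \<comment> \<open>With finitely many possible supports, one of them occurs for infinitely many
    \<open>M\<close>.\<close>
  have "finite (range supp)"
    using fin by (rule finite_subset[rotated, OF finite_Pow_iff[THEN iffD2]]) (auto simp: supp_def)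
  then obtain M0 where inf: "infinite {M. supp M = supp M0}"
    using pigeonhole_infinite[of "UNIV :: nat set" supp] by auto
  have off: "c M I = 0" if "supp M = supp M0" "I \<in> Vs" "I \<notin> supp M0" for M I
  proof -
    have "I \<notin> supp M" using that by simp
    then have "\<not> 0 < c M I" using that(2) unfolding supp_def by blast
    then show ?thesis using c(1)[OF that(2), of M] by simp
  qed
  obtain M1 where M1: "supp M1 = supp M0" "M0 < M1"
    using inf unfolding infinite_nat_iff_unbounded by auto
  \<comment> \<open>The representations with support \<open>supp M0\<close> depend affinely on \<open>M\<close>, so a negative slope
      would eventually make a coefficient negative.\<close>
  have mono: "c M0 I \<le> c M1 I" if I: "I \<in> Vs" for I
  proof (rule ccontr)
    assume "\<not> c M0 I \<le> c M1 I"
    moreover obtain i j where ij: "c M0 I = of_int i" "c M1 I = of_int j"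
      using c(1)[OF I] by (metis Ints_cases)
    ultimately have less: "c M1 I \<le> c M0 I - 1" by simp
    \<comment> \<open>\<open>M\<close> is so large that an integral drop of at least 1 between
      \<open>M0\<close> and \<open>M1\<close>, continued at the same rate, would make the
      coefficient at \<open>M\<close> negative.\<close>
    obtain M where M: "supp M = supp M0" "M > M1 + nat \<lceil>real (M1 - M0) * c M0 I\<rceil>"
      using inf unfolding infinite_nat_iff_unbounded by auto
    \<comment> \<open>\<open>M1\<close> lies between \<open>M0\<close> and \<open>M\<close>, so its
      point is a weighted mean of the other two; uniqueness on \<open>supp M0\<close> carries this
      over to the coefficients.\<close>
    have "real (M1 - M0) * c M I + real (M - M1) * c M0 I = real (M - M0) * c M1 I"
    proof (rule unique_on_face[OF supp supp _ _ _ _ _ _ I])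
      show "(\<Sum>I\<in>Vs. real (M1 - M0) * c M I + real (M - M1) * c M0 I) =
          (\<Sum>I\<in>Vs. real (M - M0) * c M1 I)"
      proof -
        have "(\<Sum>I\<in>Vs. real (M1 - M0) * c M I + real (M - M1) * c M0 I) =
            real (M1 - M0) * (real M * T + 1) + real (M - M1) * (real M0 * T + 1)"
          unfolding c(3)[symmetric] by (simp add: sum.distrib sum_distrib_left)
        also have "\<dots> = real (M - M0) * (real M1 * T + 1)"
          using M M1 by (simp add: of_nat_diff algebra_simps)
        finally show ?thesis unfolding c(3)[symmetric] by (simp add: sum_distrib_left)
      qed
      have "(\<Sum>I\<in>Vs. (real (M1 - M0) * c M I + real (M - M1) * c M0 I) *\<^sub>R X I) =
          real (M1 - M0) *\<^sub>R (real M *\<^sub>R s + X J) + real (M - M1) *\<^sub>R (real M0 *\<^sub>R s + X J)"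
        unfolding c(4)[symmetric] by (simp add: sum.distrib scaleR_add_left scaleR_sum_right)
      also have "\<dots> = real (M - M0) *\<^sub>R (real M1 *\<^sub>R s + X J)"
        using M M1 by (simp add: of_nat_diff algebra_simps)
      finally show "(\<Sum>I\<in>Vs. (real (M1 - M0) * c M I + real (M - M1) * c M0 I) *\<^sub>R X I) =
          (\<Sum>I\<in>Vs. (real (M - M0) * c M1 I) *\<^sub>R X I)"
        unfolding c(4)[symmetric] by (simp add: scaleR_sum_right)
    qed (use c(1) off M(1) M1(1) in auto)
    moreover have "real (M - M0) * c M1 I \<le> real (M - M0) * (c M0 I - 1)"
      using less by (intro mult_left_mono) auto
    moreover have "0 \<le> real (M1 - M0) * c M I" using c(1)[OF I] by simp
    ultimately have "real (M - M0) \<le> real (M1 - M0) * c M0 I"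
      using M M1 by (simp add: of_nat_diff algebra_simps)
    moreover have "real (M1 - M0) * c M0 I < real (M - M0)"
      using M(2) M1(2) by linarith
    ultimately show False by simp
  qed
  \<comment> \<open>Both sides represent \<open>M1 - M0\<close> times \<open>s\<close>: the left one
    on \<open>supp M0\<close>, nonnegative by \<open>mono\<close>, the right one on
    \<open>\<sigma>\<close>.\<close>
  have diff: "c M1 I - c M0 I = real (M1 - M0) * one I" if "I \<in> Vs" for I
  proof (rule unique_on_face[OF supp \<sigma> _ _ _ _ _ _ that])
    show "(\<Sum>I\<in>Vs. c M1 I - c M0 I) = (\<Sum>I\<in>Vs. real (M1 - M0) * one I)"
      using M1(2) by (simp add: sum_subtractf c(3) sum_distrib_left[symmetric] T_def[symmetric]
          of_nat_diff algebra_simps)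
    have "(\<Sum>I\<in>Vs. (c M1 I - c M0 I) *\<^sub>R X I) = real (M1 - M0) *\<^sub>R s"
      using M1(2) by (simp add: scaleR_diff_left sum_subtractf c(4) of_nat_diff)
    then show "(\<Sum>I\<in>Vs. (c M1 I - c M0 I) *\<^sub>R X I) = (\<Sum>I\<in>Vs. (real (M1 - M0) * one I) *\<^sub>R X I)"
      by (simp add: s_def scaleR_sum_right)
    show "c M1 I - c M0 I = 0" if "I \<in> Vs" "I \<notin> supp M0" for I
      using off[OF M1(1) that] off[OF refl that] by simp
  qed (use mono in \<open>auto simp: one_def\<close>)
  have "\<sigma> \<subseteq> supp M0"
  proof
    fix I assume I: "I \<in> \<sigma>"
    then have "I \<in> Vs" using sub(1) by blast
    show "I \<in> supp M0"
    proof (rule ccontr)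
      assume "I \<notin> supp M0"
      then have "real (M1 - M0) * one I = 0"
        using diff[OF \<open>I \<in> Vs\<close>] \<open>I \<in> Vs\<close> off[of M1 I] off[of M0 I] M1(1) by simp
      then show False using M1(2) I by (simp add: one_def)
    qed
  qed
  then have eq: "supp M0 = \<sigma>" using max supp by (auto simp: maximal_face_def)
  \<comment> \<open>\<open>M0\<close> copies of the vertex sum are removed; the floor only turns
    integral reals into integers.\<close>
  define g where "g I = \<lfloor>c M0 I\<rfloor> - int M0" for I
  have g: "of_int (g I) = c M0 I - real M0" if "I \<in> \<sigma>" for I
  proof -
    have "c M0 I \<in> \<int>" using c(1) that sub(1) by blast
    then show ?thesis by (auto simp: g_def elim: Ints_cases)
  qed
  have restr: "sum (c M0) Vs = sum (c M0) \<sigma>" "(\<Sum>I\<in>Vs. c M0 I *\<^sub>R X I) = (\<Sum>I\<in>\<sigma>. c M0 I *\<^sub>R X I)"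
    using off[OF refl] sub fin unfolding eq by (auto intro!: sum.mono_neutral_right)
  have one: "T = card \<sigma>" "s = (\<Sum>I\<in>\<sigma>. X I)"
    by (simp_all add: T_def s_def one_def sum_face[OF sub(1)] sum_face_scaleR[OF sub(1)])
  have "real_of_int (sum g \<sigma>) = 1"
    using c(3)[of M0] by (simp add: g sum_subtractf restr one algebra_simps)
  then have "sum g \<sigma> = 1" by linarith
  moreover have "X J = (\<Sum>I\<in>\<sigma>. of_int (g I) *\<^sub>R X I)"
    using c(4)[of M0]
    by (simp add: g sum_subtractf scaleR_diff_left restr one scaleR_sum_right algebra_simps)
  ultimately show ?thesis by blast
qed

end

subsection \<open>The order polytope\<close>

lemma sum_fun_at: "(\<Sum>i\<in>A. f i) x = (\<Sum>i\<in>A. f i x)" for f :: "'i \<Rightarrow> 'a \<Rightarrow> 'b::comm_monoid_add"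
  by (induction A rule: infinite_finite_induct) auto

lemma scaleR_fun_at: "(r *\<^sub>R f) x = r *\<^sub>R f x" for f :: "'a \<Rightarrow> 'b::real_vector"
  by (simp add: scaleR_fun_def)

lemma finite_Pkn: "finite (Pkn k n)"
  by (rule finite_subset[of _ "{..k} \<times> {..n}"]) (auto simp: Pkn_def)

lemma ent_less:
  assumes "I \<in> V k n" "1 \<le> a" "a < b" "b \<le> k"
  shows "ent I a < ent I b"
proof -
  have "sorted_wrt (<) I" "length I = k" using assms(1) by (auto simp: V_def)
  then show ?thesis using assms by (auto simp: ent_def intro: sorted_wrt_nth_less)
qed

lemma ent_le_top_entry:
  assumes "I \<in> V k n" "1 \<le> a" "a \<le> k"
  shows "a \<le> ent I a" "ent I a + (k - a) \<le> top_entry I" "top_entry I \<le> n"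
proof -
  have "a \<le> ent I a \<and> ent I a + (k - a) \<le> top_entry I \<and> top_entry I \<le> n"
    using assms
  proof (induction k arbitrary: I a)
    case (Suc k)
    then obtain J p where I: "I = J @ [p]" "J \<in> V k n" "top_entry J < p" "p \<le> n"
      by (auto simp: V_Suc)
    have "k \<le> top_entry J" using Suc.IH[OF I(2), of k] by (cases k) auto
    then show ?case
      using I Suc.prems Suc.IH[OF I(2), of a] ent_snoc[OF I(2), of a p] ent_snoc_last[OF I(2), of p]
      by (cases "a = Suc k") (auto simp: top_entry_def)
  qed simp
  then show "a \<le> ent I a" "ent I a + (k - a) \<le> top_entry I" "top_entry I \<le> n" by auto
qed

lemma ent_upper:
  assumes "I \<in> V k n" "1 \<le> a" "a \<le> k"
  shows "ent I a \<le> n - k + a"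
  using ent_le_top_entry[OF assms] assms(3) by linarith

lemma sum_chi_at:
  "(\<Sum>I\<in>V k n. c I *\<^sub>R chi k n I) (a, b) =
     (if (a, b) \<in> Pkn k n then cum n k c a (a + b - 1) else 0)"
  by (simp add: sum_fun_at scaleR_fun_at chi_def cum_def if_distrib cong: if_cong)

lemma chi_mem_order_polytope:
  assumes "I \<in> V k n"
  shows "chi k n I \<in> order_polytope k n"
  unfolding order_polytope_def
proof (intro CollectI conjI allI impI ballI)
  fix a b assume ab: "(a, b) \<in> Pkn k n \<and> (a + 1, b) \<in> Pkn k n"
  then have "ent I a < ent I (Suc a)" using ent_less[OF assms, of a "Suc a"] by (auto simp: Pkn_def)
  then show "chi k n I (a + 1, b) \<le> chi k n I (a, b)" using ab by (auto simp: chi_def)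
qed (auto simp: chi_def)

lemma convex_order_polytope: "convex (order_polytope k n)"
  unfolding convex_def
proof (intro ballI allI impI)
  fix x y :: "nat \<times> nat \<Rightarrow> real" and u v :: real
  assume x: "x \<in> order_polytope k n" and y: "y \<in> order_polytope k n"
    and uv: "0 \<le> u" "0 \<le> v" "u + v = 1"
  have at: "(u *\<^sub>R x + v *\<^sub>R y) p = u * x p + v * y p" for p
    by (simp add: scaleR_fun_at)
  have le: "u * r + v * s \<le> u * r' + v * s'" if "r \<le> r'" "s \<le> s'" for r r' s s'
    using that uv by (intro add_mono mult_left_mono)
  have "u * x p + v * y p \<le> 1" if "p \<in> Pkn k n" for p
    using le[of "x p" 1 "y p" 1] x y uv(3) that by (simp add: order_polytope_def)
  then show "u *\<^sub>R x + v *\<^sub>R y \<in> order_polytope k n"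
    using x y uv unfolding order_polytope_def at by (auto intro!: le)
qed

section \<open>Unit vectors as differences of vertices\<close>

definition stair :: "nat \<Rightarrow> nat \<Rightarrow> nat \<Rightarrow> nat \<Rightarrow> nat list" where
  "stair k n a t = map (\<lambda>l. if l < a then l else if l = a then a + t else l + (n - k)) [1..<Suc k]"

lemma ent_stair:
  "1 \<le> l \<Longrightarrow> l \<le> k \<Longrightarrow> ent (stair k n a t) l = (if l < a then l else if l = a then a + t else l + (n - k))"
  unfolding ent_def stair_def by (subst nth_map) (auto simp del: upt_Suc)

lemma stair_mem_V:
  assumes "k \<le> n" "1 \<le> a" "t \<le> n - k"
  shows "stair k n a t \<in> V k n"
  using assms by (auto simp: V_def stair_def sorted_wrt_map sorted_wrt_iff_nth_less simp del: upt_Suc)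

definition unit_at :: "nat \<times> nat \<Rightarrow> nat \<times> nat \<Rightarrow> real" where
  "unit_at p q = (if q = p then 1 else 0)"

text \<open>On \<open>Pkn k n\<close>, the vertex of \<open>stair k n a t\<close> is 1 in the rows
  before \<open>a\<close>, 0 in the rows after \<open>a\<close>, and 1 in row \<open>a\<close> from
  column \<open>t + 1\<close> on. Lowering \<open>t\<close> from \<open>b\<close> to
  \<open>b - 1\<close> adds the single cell \<open>(a, b)\<close>.\<close>

lemma unit_at_eq_diff:
  assumes "(a, b) \<in> Pkn k n"
  shows "unit_at (a, b) = chi k n (stair k n a (b - 1)) - chi k n (stair k n a b)"
proof
  fix q :: "nat \<times> nat"
  obtain l c where q: "q = (l, c)" by (cases q)
  show "unit_at (a, b) q = (chi k n (stair k n a (b - 1)) - chi k n (stair k n a b)) q"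
    unfolding q using assms
    by (cases "(l, c) \<in> Pkn k n") (auto simp: unit_at_def chi_def ent_stair Pkn_def)
qed

lemma sum_unit_at:
  assumes "finite P" "\<And>p. p \<notin> P \<Longrightarrow> z p = 0"
  shows "z = (\<Sum>p\<in>P. z p *\<^sub>R unit_at p)"
proof
  fix q
  have "(\<Sum>p\<in>P. z p *\<^sub>R unit_at p) q = (\<Sum>p\<in>P. if q = p then z p else 0)"
    by (simp add: sum_fun_at scaleR_fun_at unit_at_def if_distrib cong: if_cong)
  then show "z q = (\<Sum>p\<in>P. z p *\<^sub>R unit_at p) q" using assms by simp
qed

lemma inj_unit_at: "inj unit_at"
  by (rule injI) (metis unit_at_def zero_neq_one)

lemma independent_unit_at:
  assumes "finite P"
  shows "independent (unit_at ` P)"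
proof (rule independent_if_scalars_zero)
  fix f x assume f: "(\<Sum>x\<in>unit_at ` P. f x *\<^sub>R x) = 0" and "x \<in> unit_at ` P"
  then obtain q where q: "q \<in> P" "x = unit_at q" by auto
  have "0 = (\<Sum>x\<in>unit_at ` P. f x *\<^sub>R x) q" using f by simp
  also have "\<dots> = (\<Sum>p\<in>P. if q = p then f (unit_at p) else 0)"
    using inj_unit_at
    by (simp add: sum.reindex inj_on_subset sum_fun_at scaleR_fun_at if_distrib
        unit_at_def[of _ q] cong: if_cong)
  also have "\<dots> = f x" using q assms by simp
  finally show "f x = 0" by simp
qed (use assms in simp)

section \<open>Representations in the cone and the triangulation of the polytope\<close>

context greedy_relation
begin

lemma R_refl: "I \<in> V k n \<Longrightarrow> R k I I"
proof (induction k arbitrary: I)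
  case 0
  then show ?case by (simp add: V_0 R_Nil)
next
  case (Suc k)
  then obtain J p where J: "I = J @ [p]" "J \<in> V k n" by (auto simp: V_Suc)
  then show ?case using R_snoc[of J p k J p] Suc by simp
qed

text \<open>Equal points have equal distribution functions. Entry \<open>a\<close> lies between
  \<open>a\<close> and \<open>n - k + a\<close>, so the values are \<open>0\<close> before this
  range, the total weight from its end on, and coordinates of the point in between.\<close>

lemma weighting_eq_if_sum_chi_eq:
  assumes "k \<le> n" "weighting k c" "weighting k d" "sum c (V k n) = sum d (V k n)"
    and eq: "(\<Sum>I\<in>V k n. c I *\<^sub>R chi k n I) = (\<Sum>I\<in>V k n. d I *\<^sub>R chi k n I)" and "I \<in> V k n"
  shows "c I = d I"
proof (rule weighting_unique[OF assms(2-4) _ assms(6)])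
  fix a x :: nat assume a: "1 \<le> a" "a \<le> k"
  consider "x < a" | "n - k + a \<le> x" | "a \<le> x" "x < n - k + a" by linarith
  then show "cum n k c a x = cum n k d a x"
  proof cases
    case 1
    then have "cum n k e a x = 0" for e
      unfolding cum_def using ent_le_top_entry(1)[OF _ a] by (intro sum.neutral) fastforce
    then show ?thesis by simp
  next
    case 2
    then have "cum n k e a x = sum e (V k n)" for e
      unfolding cum_def using ent_upper[OF _ a] by (intro sum.cong) fastforce+
    then show ?thesis using assms(4) by simp
  next
    case 3
    then have "(a, Suc x - a) \<in> Pkn k n" "a + (Suc x - a) - 1 = x" using a by (auto simp: Pkn_def)
    then show ?thesis
      using sum_chi_at[of c k n a "Suc x - a"] sum_chi_at[of d k n a "Suc x - a"] eq by simp
  qed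
qed

text \<open>The assumptions place \<open>y\<close> in \<open>T\<close> times the order polytope. Its
  rows are read as distribution functions of the entries, and the inequalities between and along
  rows become those of \<open>weighting_exists\<close>.\<close>

lemma weighting_of_cone:
  fixes y :: "nat \<times> nat \<Rightarrow> real"
  assumes "k \<le> n" "0 \<le> T" and off: "\<And>p. p \<notin> Pkn k n \<Longrightarrow> y p = 0"
    and bounds: "\<And>p. p \<in> Pkn k n \<Longrightarrow> 0 \<le> y p \<and> y p \<le> T"
    and right: "\<And>a b. (a, b) \<in> Pkn k n \<Longrightarrow> (a, b + 1) \<in> Pkn k n \<Longrightarrow> y (a, b) \<le> y (a, b + 1)"
    and down: "\<And>a b. (a, b) \<in> Pkn k n \<Longrightarrow> (a + 1, b) \<in> Pkn k n \<Longrightarrow> y (a + 1, b) \<le> y (a, b)"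
  shows "\<exists>c. weighting k c \<and> sum c (V k n) = T \<and> (\<Sum>I\<in>V k n. c I *\<^sub>R chi k n I) = y \<and>
    (T \<in> \<int> \<longrightarrow> (\<forall>p. y p \<in> \<int>) \<longrightarrow> (\<forall>I\<in>V k n. c I \<in> \<int>))"
proof -
  \<comment> \<open>The index \<open>p + 1 - a\<close> inverts \<open>p = a + b - 1\<close>. Padding
    by \<open>0\<close> before and \<open>T\<close> after makes every row run from \<open>0\<close>
    to \<open>T\<close>.\<close>
  define F where "F a p = (if a = 0 \<or> n - k + a \<le> p then T else if p < a then 0 else y (a, p + 1 - a))"
    for a p
  have F_bounds: "0 \<le> F a p \<and> F a p \<le> T" if "a \<le> k" for a p
  proof (cases "a = 0 \<or> n - k + a \<le> p \<or> p < a")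
    case False
    then have "(a, p + 1 - a) \<in> Pkn k n" using that by (auto simp: Pkn_def)
    then show ?thesis using bounds False by (simp add: F_def)
  qed (use assms(2) in \<open>auto simp: F_def\<close>)
  have "F (Suc a) (Suc p) \<le> F a p" if a: "a < k" for a p
  proof (cases "a = 0 \<or> n - k + a \<le> p \<or> p < a")
    case True
    then show ?thesis using F_bounds[of "Suc a" "Suc p"] a by (auto simp: F_def)
  next
    case False
    \<comment> \<open>Both arguments of \<open>F\<close> grow by one, so the column index of
      \<open>y\<close> stays the same and \<open>down\<close> applies.\<close>
    then show ?thesis using down[of a "p + 1 - a"] a by (auto simp: F_def Pkn_def Suc_diff_le)
  qed
  moreover have "F (Suc a) p \<le> F (Suc a) (Suc p)" if a: "a < k" for a p
  proof -
    consider "n - k + Suc a \<le> Suc p" | "p < Suc a" "\<not> n - k + Suc a \<le> Suc p"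
      | "Suc a \<le> p" "\<not> n - k + Suc a \<le> Suc p" by linarith
    then show ?thesis
    proof cases
      case 1
      then have "F (Suc a) (Suc p) = T" by (simp add: F_def)
      then show ?thesis using F_bounds[of "Suc a" p] a by simp
    next
      case 2
      then have "F (Suc a) p = 0" by (simp add: F_def)
      then show ?thesis using F_bounds[of "Suc a" "Suc p"] a by simp
    next
      case 3
      then show ?thesis using right[of "Suc a" "p - a"] a by (auto simp: F_def Pkn_def Suc_diff_le)
    qed
  qed
  ultimately have "\<exists>c. weighting k c \<and> sum c (V k n) = T \<and>
           (\<forall>a x. 1 \<le> a \<and> a \<le> k \<and> x \<le> n \<longrightarrow> cum n k c a x = F a x) \<and>
           ((\<forall>a p. F a p \<in> \<int>) \<longrightarrow> (\<forall>I\<in>V k n. c I \<in> \<int>))"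
    using assms(1,2) by (intro weighting_exists) (auto simp: F_def)
  then obtain c where c: "weighting k c" "sum c (V k n) = T"
      "\<forall>a x. 1 \<le> a \<and> a \<le> k \<and> x \<le> n \<longrightarrow> cum n k c a x = F a x"
      "(\<forall>a p. F a p \<in> \<int>) \<longrightarrow> (\<forall>I\<in>V k n. c I \<in> \<int>)" by blast
  have "(\<Sum>I\<in>V k n. c I *\<^sub>R chi k n I) (a, b) = y (a, b)" for a b
  proof (cases "(a, b) \<in> Pkn k n")
    case True
    then have "cum n k c a (a + b - 1) = F a (a + b - 1)" using c(3) assms(1) by (auto simp: Pkn_def)
    then show ?thesis using True by (auto simp: sum_chi_at F_def Pkn_def)
  qed (simp add: sum_chi_at off)
  then have "(\<Sum>I\<in>V k n. c I *\<^sub>R chi k n I) = y" by auto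
  moreover have "\<forall>I\<in>V k n. c I \<in> \<int>" if "T \<in> \<int>" "\<forall>p. y p \<in> \<int>"
    using c(4) that by (auto simp: F_def)
  ultimately show ?thesis using c(1,2) by blast
qed

text \<open>The height \<open>T\<close> counts the vertices with multiplicity. Their sum is an
  integral point of \<open>T\<close> times the polytope, so it has an integral representation
  supported on a face.\<close>

lemma straightening_V:
  assumes "k \<le> n"
  shows "straightening (V k n) (chi k n) (R k)"
proof
  show "finite (V k n)" by (rule finite_V)
  show "R k I I" if "I \<in> V k n" for I using that by (rule R_refl)
  show "c I = d I"
    if "\<forall>I\<in>V k n. 0 \<le> c I" "\<forall>I\<in>V k n. \<forall>J\<in>V k n. 0 < c I \<and> 0 < c J \<longrightarrow> R k I J"
      "\<forall>I\<in>V k n. 0 \<le> d I" "\<forall>I\<in>V k n. \<forall>J\<in>V k n. 0 < d I \<and> 0 < d J \<longrightarrow> R k I J"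
      "sum c (V k n) = sum d (V k n)"
      "(\<Sum>I\<in>V k n. c I *\<^sub>R chi k n I) = (\<Sum>I\<in>V k n. d I *\<^sub>R chi k n I)" "I \<in> V k n"
    for c d I
  proof (rule weighting_eq_if_sum_chi_eq[OF assms _ _ that(5-7)])
    show "weighting k c" using that(1,2) unfolding weighting_def by blast
    show "weighting k d" using that(3,4) unfolding weighting_def by blast
  qed
  fix f :: "nat list \<Rightarrow> nat"
  define y where "y = (\<Sum>I\<in>V k n. real (f I) *\<^sub>R chi k n I)"
  have y: "y p = (\<Sum>I\<in>V k n. real (f I) * chi k n I p)" for p
    by (simp add: y_def sum_fun_at scaleR_fun_at)
  note O = chi_mem_order_polytope[unfolded order_polytope_def]
  have mono: "y p \<le> y q" if "\<And>I. I \<in> V k n \<Longrightarrow> chi k n I p \<le> chi k n I q" for p q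
    unfolding y using that by (intro sum_mono mult_left_mono) auto
  have "\<exists>c. weighting k c \<and> sum c (V k n) = (\<Sum>I\<in>V k n. real (f I)) \<and>
      (\<Sum>I\<in>V k n. c I *\<^sub>R chi k n I) = y \<and>
    ((\<Sum>I\<in>V k n. real (f I)) \<in> \<int> \<longrightarrow> (\<forall>p. y p \<in> \<int>) \<longrightarrow> (\<forall>I\<in>V k n. c I \<in> \<int>))"
  proof (rule weighting_of_cone[OF assms])
    show "y p = 0" if "p \<notin> Pkn k n" for p
      unfolding y using that by (intro sum.neutral) (auto simp: chi_def split: prod.splits)
    show "0 \<le> y p \<and> y p \<le> (\<Sum>I\<in>V k n. real (f I))" if "p \<in> Pkn k n" for p
      unfolding y using that O
      by (intro conjI sum_nonneg sum_mono mult_nonneg_nonneg mult_left_le) auto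
    show "y (a, b) \<le> y (a, b + 1)" if "(a, b) \<in> Pkn k n" "(a, b + 1) \<in> Pkn k n" for a b
      using that O by (intro mono) blast
    show "y (a + 1, b) \<le> y (a, b)" if "(a, b) \<in> Pkn k n" "(a + 1, b) \<in> Pkn k n" for a b
      using that O by (intro mono) blast
  qed (simp add: sum_nonneg)
  then obtain c where c: "weighting k c" "sum c (V k n) = (\<Sum>I\<in>V k n. real (f I))"
      "(\<Sum>I\<in>V k n. c I *\<^sub>R chi k n I) = y"
      "(\<Sum>I\<in>V k n. real (f I)) \<in> \<int> \<longrightarrow> (\<forall>p. y p \<in> \<int>) \<longrightarrow> (\<forall>I\<in>V k n. c I \<in> \<int>)" by blast
  have "y p \<in> \<int>" for p
    unfolding y chi_def by (intro Ints_sum Ints_mult) (auto split: prod.split)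
  moreover have "(\<Sum>I\<in>V k n. real (f I)) \<in> \<int>" by (intro Ints_sum) auto
  ultimately show "\<exists>c. (\<forall>I\<in>V k n. c I \<in> \<int> \<and> 0 \<le> c I) \<and>
        (\<forall>I\<in>V k n. \<forall>J\<in>V k n. 0 < c I \<and> 0 < c J \<longrightarrow> R k I J) \<and>
        sum c (V k n) = (\<Sum>I\<in>V k n. real (f I)) \<and>
        (\<Sum>I\<in>V k n. c I *\<^sub>R chi k n I) = (\<Sum>I\<in>V k n. real (f I) *\<^sub>R chi k n I)"
    using c unfolding weighting_def y_def[symmetric] by (intro exI[of _ c]) blast
qed

text \<open>Covering is \<open>weighting_of_cone\<close> at height 1. For unimodularity, the integer
  span \<open>G\<close> of the edges at one vertex contains every \<open>chi k n J - v0\<close>,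
  hence the unit vectors, hence the lattice.\<close>

lemma flag_unimodular_triangulation_R:
  assumes "k \<le> n"
  shows "flag_unimodular_triangulation k n {\<sigma>. \<sigma> \<subseteq> V k n \<and> (\<forall>I\<in>\<sigma>. \<forall>J\<in>\<sigma>. R k I J)}"
proof -
  interpret S: straightening "V k n" "chi k n" "R k" by (rule straightening_V[OF assms])
  have "triangulates k n S.\<Delta>"
    unfolding triangulates_def
  proof (intro conjI ballI)
    show "\<not> affine_dependent (chi k n ` \<sigma>)" if "\<sigma> \<in> S.\<Delta>" for \<sigma>
      by (rule S.affine_independent_face[OF that])
    show "(convex hull (chi k n ` \<sigma>) \<inter> convex hull (chi k n ` \<tau>)) face_of convex hull (chi k n ` \<sigma>)"
      if "\<sigma> \<in> S.\<Delta>" "\<tau> \<in> S.\<Delta>" for \<sigma> \<tau>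
      by (rule S.hull_Int_face_of[OF that])
    show "(convex hull (chi k n ` \<sigma>) \<inter> convex hull (chi k n ` \<tau>)) face_of convex hull (chi k n ` \<tau>)"
      if "\<sigma> \<in> S.\<Delta>" "\<tau> \<in> S.\<Delta>" for \<sigma> \<tau>
      using S.hull_Int_face_of[OF that(2,1)] by (simp add: Int_commute)
    show "(\<Union>\<sigma>\<in>S.\<Delta>. convex hull (chi k n ` \<sigma>)) = order_polytope k n"
    proof (intro equalityI subsetI)
      fix x assume "x \<in> (\<Union>\<sigma>\<in>S.\<Delta>. convex hull (chi k n ` \<sigma>))"
      then obtain \<sigma> where \<sigma>: "\<sigma> \<in> S.\<Delta>" "x \<in> convex hull (chi k n ` \<sigma>)" by blast
      have "chi k n ` \<sigma> \<subseteq> order_polytope k n"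
        using S.\<Delta>_subset(1)[OF \<sigma>(1)] chi_mem_order_polytope by blast
      then show "x \<in> order_polytope k n"
        using hull_minimal[where S = convex, OF _ convex_order_polytope] \<sigma>(2) by blast
    next
      fix x assume x: "x \<in> order_polytope k n"
      obtain c where c: "weighting k c" "sum c (V k n) = 1" "(\<Sum>I\<in>V k n. c I *\<^sub>R chi k n I) = x"
        using weighting_of_cone[OF assms, of 1 x] x unfolding order_polytope_def by auto
      let ?\<sigma> = "{I\<in>V k n. 0 < c I}"
      have \<sigma>: "?\<sigma> \<in> S.\<Delta>" using c(1) by (auto simp: S.\<Delta>_def weighting_def)
      have "\<forall>I\<in>V k n. 0 \<le> c I" "\<forall>I\<in>V k n. I \<notin> ?\<sigma> \<longrightarrow> c I = 0"
        using c(1) by (auto simp: weighting_def order_le_less)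
      then have "x \<in> convex hull (chi k n ` ?\<sigma>)"
        unfolding S.mem_hull_face[OF \<sigma>] using c(2,3) by blast
      then show "x \<in> (\<Union>\<sigma>\<in>S.\<Delta>. convex hull (chi k n ` \<sigma>))" using \<sigma> by blast
    qed
  qed
  moreover have "unimodular k n S.\<Delta>"
    unfolding unimodular_def
  proof (intro allI impI)
    fix \<sigma> assume max: "maximal_face S.\<Delta> \<sigma>"
    then have \<sigma>: "\<sigma> \<in> S.\<Delta>" by (simp add: maximal_face_def)
    note sub = S.\<Delta>_subset[OF \<sigma>]
    have inj: "inj_on (chi k n) \<sigma>" using S.inj_X sub(1) by (rule inj_on_subset)
    have "\<sigma> \<noteq> {}"
      \<comment> \<open>\<open>stair k n 1 0\<close> is just some vertex; its singleton shows that
        the empty face is not maximal.\<close>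
      using max S.singleton_face[OF stair_mem_V[OF assms, of 1 0]] by (auto simp: maximal_face_def)
    then obtain I0 where I0: "I0 \<in> \<sigma>" by blast
    define S where "S = chi k n ` \<sigma>"
    define v0 where "v0 = chi k n I0"
    define G where "G = {z. \<exists>c :: (nat \<times> nat \<Rightarrow> real) \<Rightarrow> int. z = (\<Sum>v\<in>S - {v0}. of_int (c v) *\<^sub>R (v - v0))}"
    have S: "finite S" "v0 \<in> S" using sub(2) I0 by (auto simp: S_def v0_def)
    have G_0: "0 \<in> G" unfolding G_def by (intro CollectI exI[of _ "\<lambda>_. 0"]) simp
    have G_add: "x + y \<in> G" if "x \<in> G" "y \<in> G" for x y
    proof -
      obtain c d :: "(nat \<times> nat \<Rightarrow> real) \<Rightarrow> int"
        where "x = (\<Sum>v\<in>S - {v0}. of_int (c v) *\<^sub>R (v - v0))"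
          "y = (\<Sum>v\<in>S - {v0}. of_int (d v) *\<^sub>R (v - v0))" using \<open>x \<in> G\<close> \<open>y \<in> G\<close> unfolding G_def by blast
      then have "x + y = (\<Sum>v\<in>S - {v0}. of_int (c v + d v) *\<^sub>R (v - v0))"
        by (simp add: sum.distrib scaleR_add_left)
      then show ?thesis unfolding G_def by (intro CollectI exI[of _ "\<lambda>v. c v + d v"])
    qed
    have G_scale: "of_int m *\<^sub>R x \<in> G" if "x \<in> G" for x and m :: int
    proof -
      obtain c :: "(nat \<times> nat \<Rightarrow> real) \<Rightarrow> int"
        where "x = (\<Sum>v\<in>S - {v0}. of_int (c v) *\<^sub>R (v - v0))" using \<open>x \<in> G\<close> unfolding G_def by blast
      then have "of_int m *\<^sub>R x = (\<Sum>v\<in>S - {v0}. of_int (m * c v) *\<^sub>R (v - v0))"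
        by (simp add: scaleR_sum_right)
      then show ?thesis unfolding G_def by (intro CollectI exI[of _ "\<lambda>v. m * c v"])
    qed
    have G_sum: "(\<Sum>p\<in>P. h p) \<in> G" if "finite P" "\<And>p. p \<in> P \<Longrightarrow> h p \<in> G"
      for h :: "nat \<times> nat \<Rightarrow> nat \<times> nat \<Rightarrow> real" and P
      using that by (induction P rule: finite_induct) (auto intro: G_0 G_add)
    have G_vertex: "chi k n J - v0 \<in> G" if J: "J \<in> V k n" for J
    proof -
      obtain g :: "nat list \<Rightarrow> int" where g: "sum g \<sigma> = 1"
          "chi k n J = (\<Sum>I\<in>\<sigma>. of_int (g I) *\<^sub>R chi k n I)"
        using S.maximal_face_integer_affine[OF max J] by blast
      define c where "c v = g (the_inv_into \<sigma> (chi k n) v)" for v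
      \<comment> \<open>Coefficients of sum 1 allow \<open>v0\<close> to be subtracted inside the
        combination.\<close>
      have "(\<Sum>I\<in>\<sigma>. real_of_int (g I)) = 1" using g(1) by (metis of_int_1 of_int_sum)
      then have "chi k n J - v0 = (\<Sum>I\<in>\<sigma>. of_int (g I) *\<^sub>R (chi k n I - v0))"
        by (simp add: g(2) scaleR_diff_right sum_subtractf scaleR_sum_left[symmetric])
      also have "\<dots> = (\<Sum>v\<in>S. of_int (c v) *\<^sub>R (v - v0))"
        unfolding S_def using inj by (simp add: sum.reindex c_def the_inv_into_f_f)
      also have "\<dots> = (\<Sum>v\<in>S - {v0}. of_int (c v) *\<^sub>R (v - v0))"
        using S by (simp add: sum.remove[of S v0])
      finally show ?thesis unfolding G_def by (intro CollectI exI[of _ c])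
    qed
    have G_unit: "unit_at p \<in> G" if p: "p \<in> Pkn k n" for p
    proof -
      obtain a b where ab: "p = (a, b)" by (cases p)
      have "stair k n a (b - 1) \<in> V k n" "stair k n a b \<in> V k n"
        using p assms unfolding ab by (auto simp: Pkn_def intro!: stair_mem_V)
      then have "(chi k n (stair k n a (b - 1)) - v0) + of_int (- 1) *\<^sub>R (chi k n (stair k n a b) - v0) \<in> G"
        by (intro G_add G_scale G_vertex)
      then show ?thesis using p unfolding ab by (simp add: unit_at_eq_diff)
    qed
    have G_lattice: "z \<in> G" if z: "z \<in> int_lattice (Pkn k n)" for z
    proof -
      have "z p *\<^sub>R unit_at p \<in> G" if "p \<in> Pkn k n" for p
      proof -
        have "z p \<in> \<int>" using z that by (auto simp: int_lattice_def)
        then obtain m where "z p = of_int m" by (auto elim: Ints_cases)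
        then show ?thesis using G_scale[OF G_unit[OF that]] by simp
      qed
      then have "(\<Sum>p\<in>Pkn k n. z p *\<^sub>R unit_at p) \<in> G" by (intro G_sum finite_Pkn)
      moreover have "z = (\<Sum>p\<in>Pkn k n. z p *\<^sub>R unit_at p)"
        using z by (intro sum_unit_at[OF finite_Pkn]) (auto simp: int_lattice_def)
      ultimately show ?thesis by simp
    qed
    \<comment> \<open>The independent edges lie in the span of the unit vectors and the independent
      unit vectors in the span of the edges, so the two families have equal size.\<close>
    let ?E = "(\<lambda>v. v - v0) ` (S - {v0})" and ?U = "unit_at ` Pkn k n"
    have card_U: "card ?U = card (Pkn k n)"
      using inj_unit_at by (intro card_image) (rule inj_on_subset, auto)
    have card_E: "card ?E = card S - 1"
      using S by (subst card_image) (auto simp: inj_on_def)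
    have "independent ?E"
      using S.affine_independent_face[OF \<sigma>] affine_dependent_iff_dependent[of v0 "S - {v0}"] S(2)
      by (simp add: S_def[symmetric] insert_absorb)
    moreover have "?E \<subseteq> span ?U"
    proof
      fix w assume "w \<in> ?E"
      then obtain I where "w = chi k n I - v0" by (auto simp: S_def)
      then have "w = (\<Sum>p\<in>Pkn k n. w p *\<^sub>R unit_at p)"
        by (intro sum_unit_at[OF finite_Pkn]) (auto simp: v0_def chi_def)
      moreover have "(\<Sum>p\<in>Pkn k n. w p *\<^sub>R unit_at p) \<in> span ?U"
        by (intro span_sum span_scale span_base) auto
      ultimately show "w \<in> span ?U" by simp
    qed
    ultimately have "card ?E \<le> card ?U" using independent_span_bound[of ?U ?E] finite_Pkn by blast
    moreover have "G \<subseteq> span ?E"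
    proof
      fix z assume "z \<in> G"
      then obtain c :: "(nat \<times> nat \<Rightarrow> real) \<Rightarrow> int"
        where z: "z = (\<Sum>v\<in>S - {v0}. of_int (c v) *\<^sub>R (v - v0))" unfolding G_def by blast
      show "z \<in> span ?E" unfolding z by (intro span_sum span_scale span_base imageI)
    qed
    then have "card ?U \<le> card ?E"
      using independent_span_bound[of ?E ?U] S(1) G_unit independent_unit_at[OF finite_Pkn] by blast
    moreover have "0 < card S" using S by (auto simp: card_gt_0_iff)
    ultimately have "card S = card (Pkn k n) + 1" using card_E card_U by linarith
    moreover have "S \<subseteq> int_lattice (Pkn k n)"
      by (auto simp: S_def int_lattice_def chi_def)
    ultimately show "lattice_basis_simplex (Pkn k n) (chi k n ` \<sigma>)"
      unfolding lattice_basis_simplex_def S_def[symmetric]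
      using S G_lattice unfolding G_def by blast
  qed
  ultimately show ?thesis
    using S.flag unfolding flag_unimodular_triangulation_def S.\<Delta>_def by blast
qed

end

subsection \<open>The nonnesting and the noncrossing relation are greedy\<close>

definition colex :: "nat \<Rightarrow> nat list \<Rightarrow> nat list \<Rightarrow> bool" where
  "colex k I J \<longleftrightarrow>
     (\<exists>a. 1 \<le> a \<and> a \<le> k \<and> ent I a < ent J a \<and> (\<forall>l. a < l \<and> l \<le> k \<longrightarrow> ent I l = ent J l))"

lemma colex_asym: "colex k I J \<Longrightarrow> \<not> colex k J I"
  unfolding colex_def by (metis less_asym less_irrefl nat_neq_iff)

text \<open>The later of the two deciding positions decides the composite.\<close>

lemma colex_trans: "colex k I J \<Longrightarrow> colex k J K \<Longrightarrow> colex k I K"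
  unfolding colex_def
proof (elim exE conjE)
  fix a b assume a: "1 \<le> a" "a \<le> k" "ent I a < ent J a" "\<forall>l. a < l \<and> l \<le> k \<longrightarrow> ent I l = ent J l"
    and b: "1 \<le> b" "b \<le> k" "ent J b < ent K b" "\<forall>l. b < l \<and> l \<le> k \<longrightarrow> ent J l = ent K l"
  show "\<exists>a. 1 \<le> a \<and> a \<le> k \<and> ent I a < ent K a \<and> (\<forall>l. a < l \<and> l \<le> k \<longrightarrow> ent I l = ent K l)"
  proof (rule exI[of _ "max a b"], intro conjI)
    show "ent I (max a b) < ent K (max a b)"
      using a b by (cases a b rule: linorder_cases) (auto simp: max_def)
  qed (use a b in auto)
qed

lemma colex_total:
  assumes "I \<in> V k n" "J \<in> V k n" "I \<noteq> J"
  shows "colex k I J \<or> colex k J I"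
proof -
  let ?D = "{a. 1 \<le> a \<and> a \<le> k \<and> ent I a \<noteq> ent J a}"
  have "finite ?D" by (rule finite_subset[of _ "{..k}"]) auto
  have "\<exists>i<k. I ! i \<noteq> J ! i"
    using assms(3) nth_equalityI[of I J] length_V[OF assms(1)] length_V[OF assms(2)] by auto
  then obtain i where "i < k" "I ! i \<noteq> J ! i" by blast
  then have "Suc i \<in> ?D" by (simp add: ent_def)
  define d where "d = Max ?D"
  have "?D \<noteq> {}" using \<open>Suc i \<in> ?D\<close> by blast
  then have d: "d \<in> ?D" using \<open>finite ?D\<close> unfolding d_def by (intro Max_in)
  have above: "ent I l = ent J l" if "d < l" "l \<le> k" for l
  proof (rule ccontr)
    assume "ent I l \<noteq> ent J l"
    then have "l \<in> ?D" using that by auto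
    then have "l \<le> d" using \<open>finite ?D\<close> unfolding d_def by (intro Max_ge)
    then show False using that(1) by simp
  qed
  show ?thesis
  proof (cases "ent I d < ent J d")
    case True
    then have "colex k I J" using d above unfolding colex_def by blast
    then show ?thesis ..
  next
    case False
    then have "ent J d < ent I d" using d by simp
    then have "colex k J I" using d above unfolding colex_def by fastforce
    then show ?thesis ..
  qed
qed

lemma colex_orders:
  "asymp_on (V k n) (colex k)" "transp_on (V k n) (colex k)" "totalp_on (V k n) (colex k)"
proof -
  show "asymp_on (V k n) (colex k)" unfolding asymp_on_def using colex_asym by blast
  show "transp_on (V k n) (colex k)" unfolding transp_on_def using colex_trans by blast
  show "totalp_on (V k n) (colex k)" unfolding totalp_on_def using colex_total by blast
qed

section \<open>Nonnesting vectors\<close>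

lemma nonnesting_sym: "nonnesting k I J \<longleftrightarrow> nonnesting k J I"
  by (auto simp: nonnesting_def arcs_nest_def)

text \<open>A reversed inequality at \<open>a\<close> would sit before the deciding position
  \<open>b\<close>, and \<open>ent J a < ent I a < ent I b < ent J b\<close> is a nesting. So on
  nonnesting pairs colex is comparison entry by entry.\<close>

lemma nonnesting_colex_le:
  assumes "nonnesting k I J" "colex k I J" "I \<in> V k n" "J \<in> V k n" "1 \<le> a" "a \<le> k"
  shows "ent I a \<le> ent J a"
proof (rule ccontr)
  assume less: "\<not> ent I a \<le> ent J a"
  obtain b where b: "1 \<le> b" "b \<le> k" "ent I b < ent J b" "\<forall>l. b < l \<and> l \<le> k \<longrightarrow> ent I l = ent J l"
    using assms(2) by (auto simp: colex_def)
  have "a < b"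
  proof (rule ccontr)
    assume "\<not> a < b"
    then have "ent I a \<le> ent J a" using b(3,4) assms(6) by (cases "a = b") auto
    then show False using less by simp
  qed
  then have "arcs_nest (ent I a, ent I b) (ent J a, ent J b)"
    using less b(3) ent_less[OF assms(3) assms(5) \<open>a < b\<close> b(2)] by (simp add: arcs_nest_def)
  then show False using assms(1,5) b(2) \<open>a < b\<close> by (auto simp: nonnesting_def)
qed

lemma nonnesting_Suc:
  assumes "I \<in> V k n" "J \<in> V k n"
  shows "nonnesting (Suc k) (I @ [p]) (J @ [q]) \<longleftrightarrow> nonnesting k I J \<and>
    (\<forall>a. 1 \<le> a \<and> a \<le> k \<longrightarrow> \<not> arcs_nest (ent I a, p) (ent J a, q))"
proof -
  have split: "(\<forall>a b. 1 \<le> a \<and> a < b \<and> b \<le> Suc k \<longrightarrow> Q a b) \<longleftrightarrow>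
      (\<forall>a b. 1 \<le> a \<and> a < b \<and> b \<le> k \<longrightarrow> Q a b) \<and> (\<forall>a. 1 \<le> a \<and> a \<le> k \<longrightarrow> Q a (Suc k))" for Q
    by (auto simp: le_Suc_eq)
  show ?thesis
    unfolding nonnesting_def split
    by (simp add: ent_snoc[OF assms(1)] ent_snoc[OF assms(2)] ent_snoc_last[OF assms(1)]
        ent_snoc_last[OF assms(2)] cong: conj_cong imp_cong)
qed

text \<open>Each appended entry exceeds its own vector, so the new arcs nest iff left and right ends
  are ordered oppositely. Left ends of a nonnesting pair follow colex, so a nesting is an
  inversion.\<close>

lemma nonnesting_snoc_iff:
  assumes I: "I \<in> V k n" and J: "J \<in> V k n" and pq: "top_entry I < p" "top_entry J < q"
  shows "nonnesting (Suc k) (I @ [p]) (J @ [q]) \<longleftrightarrow>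
    nonnesting k I J \<and> \<not> (colex k J I \<and> top_entry J < p \<and> p < q) \<and>
      \<not> (colex k I J \<and> top_entry I < q \<and> q < p)"
proof -
  have below: "ent I a < p" "ent J a < q" if "1 \<le> a" "a \<le> k" for a
    using ent_le_top_entry(2)[OF I that] ent_le_top_entry(2)[OF J that] pq by linarith+
  have nest: "arcs_nest (ent I a, p) (ent J a, q) \<longleftrightarrow>
      ent I a < ent J a \<and> q < p \<or> ent J a < ent I a \<and> p < q" if "1 \<le> a" "a \<le> k" for a
    using below[OF that] by (auto simp: arcs_nest_def)
  \<comment> \<open>One strict inequality fixes the colex order and with it the order of the top
    entries. So the top entry of \<open>K\<close> is below the entry appended to \<open>H\<close>,
    and availability is automatic.\<close>
  have top: "colex k K H \<and> top_entry K \<le> top_entry H"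
    if K: "K \<in> V k n" "H \<in> V k n" "nonnesting k K H" "ent K a < ent H a" and a: "1 \<le> a" "a \<le> k"
    for K H a
  proof -
    have "\<not> colex k H K"
      using nonnesting_colex_le[of k H K n a] K a nonnesting_sym[of k H K] by auto
    moreover have "K \<noteq> H" using K(4) by auto
    ultimately have KH: "colex k K H" using colex_total[OF K(1,2)] by blast
    obtain k' where "k = Suc k'" using a by (cases k) auto
    then have "top_entry K \<le> top_entry H"
      using nonnesting_colex_le[OF K(3) KH K(1,2), of k] K(1,2) by (simp add: top_entry_eq_ent)
    then show ?thesis using KH by simp
  qed
  have witness: "\<exists>a. 1 \<le> a \<and> a \<le> k \<and> ent K a < ent H a" if "colex k K H" for K H
    using that by (auto simp: colex_def)
  show ?thesis
    unfolding nonnesting_Suc[OF I J]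
  proof (intro conj_cong refl iffI)
    assume N: "nonnesting k I J"
    show "\<not> (colex k J I \<and> top_entry J < p \<and> p < q) \<and> \<not> (colex k I J \<and> top_entry I < q \<and> q < p)"
      if "\<forall>a. 1 \<le> a \<and> a \<le> k \<longrightarrow> \<not> arcs_nest (ent I a, p) (ent J a, q)"
      using that nest witness by metis
    show "\<forall>a. 1 \<le> a \<and> a \<le> k \<longrightarrow> \<not> arcs_nest (ent I a, p) (ent J a, q)"
      if "\<not> (colex k J I \<and> top_entry J < p \<and> p < q) \<and> \<not> (colex k I J \<and> top_entry I < q \<and> q < p)"
    proof (intro allI impI notI)
      fix a assume a: "1 \<le> a \<and> a \<le> k" and "arcs_nest (ent I a, p) (ent J a, q)"
      then consider "ent I a < ent J a" "q < p" | "ent J a < ent I a" "p < q" using nest by blast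
      then show False
      proof cases
        case 1
        then show False using top[OF I J N _ conjunct1[OF a] conjunct2[OF a]] that pq by auto
      next
        case 2
        have "nonnesting k J I" using N nonnesting_sym by blast
        then show False using top[OF J I _ _ conjunct1[OF a] conjunct2[OF a]] that pq 2 by auto
      qed
    qed
  qed
qed

section \<open>Noncrossing vectors\<close>

lemma noncrossing_Suc:
  assumes "I \<in> V k n" "J \<in> V k n"
  shows "noncrossing (Suc k) (I @ [p]) (J @ [q]) \<longleftrightarrow> noncrossing k I J \<and>
    (\<forall>a. 1 \<le> a \<and> a \<le> k \<and> (\<forall>l. a < l \<and> l \<le> k \<longrightarrow> ent I l = ent J l) \<longrightarrow>
      \<not> arcs_cross (ent I a, p) (ent J a, q))"
proof -
  let ?K = "I @ [p]" and ?H = "J @ [q]"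
  define Q where "Q K H a b \<longleftrightarrow> ((\<forall>l. a < l \<and> l < b \<longrightarrow> ent K l = ent H l) \<longrightarrow>
    \<not> arcs_cross (ent K a, ent K b) (ent H a, ent H b))" for K H a b
  have NC: "noncrossing m K H \<longleftrightarrow> (\<forall>a b. 1 \<le> a \<and> a < b \<and> b \<le> m \<longrightarrow> Q K H a b)" for m K H
    unfolding noncrossing_def Q_def by blast
  have ent: "ent ?K l = ent I l" "ent ?H l = ent J l" if "1 \<le> l" "l \<le> k" for l
    using that ent_snoc assms by auto
  \<comment> \<open>Only positions up to \<open>k\<close> lie strictly between \<open>a\<close> and
    \<open>b\<close>, so the appended entries do not affect the agreement condition.\<close>
  have between: "(\<forall>l. a < l \<and> l < b \<longrightarrow> ent ?K l = ent ?H l) \<longleftrightarrow>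
      (\<forall>l. a < l \<and> l < b \<longrightarrow> ent I l = ent J l)" if "1 \<le> a" "b \<le> Suc k" for a b
    using that ent by auto
  have inner: "Q ?K ?H a b \<longleftrightarrow> Q I J a b" if "1 \<le> a" "a < b" "b \<le> k" for a b
  proof -
    have "a \<le> k" "1 \<le> b" "b \<le> Suc k" using that by auto
    then show ?thesis unfolding Q_def using that by (simp only: ent between)
  qed
  have last: "Q ?K ?H a (Suc k) \<longleftrightarrow> ((\<forall>l. a < l \<and> l \<le> k \<longrightarrow> ent I l = ent J l) \<longrightarrow>
      \<not> arcs_cross (ent I a, p) (ent J a, q))" if "1 \<le> a" "a \<le> k" for a
    unfolding Q_def
    by (simp only: ent[OF that] between[OF that(1) order_refl, unfolded less_Suc_eq_le] ent_snoc_last[OF assms(1)]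
        ent_snoc_last[OF assms(2)] less_Suc_eq_le)
  have "noncrossing (Suc k) ?K ?H \<longleftrightarrow>
      (\<forall>a b. 1 \<le> a \<and> a < b \<and> b \<le> k \<longrightarrow> Q ?K ?H a b) \<and>
      (\<forall>a. 1 \<le> a \<and> a \<le> k \<longrightarrow> Q ?K ?H a (Suc k))"
    unfolding NC by (auto simp: le_Suc_eq)
  then show ?thesis unfolding NC[of k] using inner last by blast
qed

text \<open>New arcs are tested at \<open>a\<close> only if the vectors agree after
  \<open>a\<close>, so a strict inequality there decides colex. If \<open>ent I a < ent J a\<close>,
  a crossing means \<open>ent J a < p < q\<close>: the colex larger \<open>J\<close> was available
  at \<open>p\<close> but was kept for \<open>q\<close>.\<close>

lemma noncrossing_snoc_iff:
  assumes I: "I \<in> V k n" and J: "J \<in> V k n" and pq: "top_entry I < p" "top_entry J < q"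
  shows "noncrossing (Suc k) (I @ [p]) (J @ [q]) \<longleftrightarrow>
    noncrossing k I J \<and> \<not> (colex k I J \<and> top_entry J < p \<and> p < q) \<and>
      \<not> (colex k J I \<and> top_entry I < q \<and> q < p)"
proof -
  define eq_above where "eq_above a \<longleftrightarrow> (\<forall>l. a < l \<and> l \<le> k \<longrightarrow> ent I l = ent J l)" for a
  have colex_iff: "colex k I J \<longleftrightarrow> (\<exists>a. 1 \<le> a \<and> a \<le> k \<and> ent I a < ent J a \<and> eq_above a)"
    "colex k J I \<longleftrightarrow> (\<exists>a. 1 \<le> a \<and> a \<le> k \<and> ent J a < ent I a \<and> eq_above a)"
    by (auto simp: colex_def eq_above_def)
  \<comment> \<open>If \<open>a < k\<close> then \<open>I\<close> and \<open>J\<close> have the same last entry, which lies below both \<open>p\<close> and \<open>q\<close>.\<close>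
  have top: "ent J a < p \<longleftrightarrow> top_entry J < p" "ent I a < q \<longleftrightarrow> top_entry I < q"
    if a: "1 \<le> a" "a \<le> k" "eq_above a" for a
  proof -
    obtain k' where k': "k = Suc k'" using a by (cases k) auto
    have tops: "top_entry I = ent I k" "top_entry J = ent J k"
      using I J unfolding k' by (simp_all add: top_entry_eq_ent)
    have le: "ent I a \<le> top_entry I" "ent J a \<le> top_entry J"
      using ent_le_top_entry(2)[OF I a(1,2)] ent_le_top_entry(2)[OF J a(1,2)] by linarith+
    have "top_entry I = top_entry J \<or> a = k"
      using a tops by (auto simp: eq_above_def)
    then show "ent J a < p \<longleftrightarrow> top_entry J < p" "ent I a < q \<longleftrightarrow> top_entry I < q"
      using le pq tops by auto
  qed
  have cross: "arcs_cross (ent I a, p) (ent J a, q) \<longleftrightarrow>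
      ent I a < ent J a \<and> top_entry J < p \<and> p < q \<or> ent J a < ent I a \<and> top_entry I < q \<and> q < p"
    if "1 \<le> a" "a \<le> k" "eq_above a" for a
    using top[OF that] by (simp add: arcs_cross_def)
  show ?thesis
    unfolding noncrossing_Suc[OF I J] eq_above_def[symmetric] colex_iff using cross by blast
qed

text \<open>The colex smaller vector is served first, as in a queue. One \<open>L\<close> must
  handle all lengths, so \<open>colex\<close> takes its length parameter from
  \<open>length I\<close>.\<close>

lemma greedy_relation_nonnesting:
  "greedy_relation n nonnesting (\<lambda>I J. colex (length I) I J)"
proof
  show "nonnesting 0 [] []" by (simp add: nonnesting_def)
  show "asymp_on (V k n) (\<lambda>I J. colex (length I) I J)" for k
    using colex_orders(1)[of k n] by (auto simp: asymp_on_def length_V)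
  show "transp_on (V k n) (\<lambda>I J. colex (length I) I J)" for k
    by (intro transp_onI) (metis colex_trans length_V)
  show "totalp_on (V k n) (\<lambda>I J. colex (length I) I J)" for k
    using colex_orders(3)[of k n] by (auto simp: totalp_on_def length_V)
qed (auto simp: snoc_mem_V length_V nonnesting_snoc_iff)

text \<open>The arguments of \<open>colex\<close> are exchanged: the colex larger vector is served
  first, as the innermost open parenthesis is closed first.\<close>

lemma greedy_relation_noncrossing:
  "greedy_relation n noncrossing (\<lambda>I J. colex (length I) J I)"
proof
  show "noncrossing 0 [] []" by (simp add: noncrossing_def)
  show "asymp_on (V k n) (\<lambda>I J. colex (length I) J I)" for k
    using colex_orders(1)[of k n] by (auto simp: asymp_on_def length_V)
  show "transp_on (V k n) (\<lambda>I J. colex (length I) J I)" for k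
    by (intro transp_onI) (metis colex_trans length_V)
  show "totalp_on (V k n) (\<lambda>I J. colex (length I) J I)" for k
    using colex_orders(3)[of k n] by (auto simp: totalp_on_def length_V)
qed (auto simp: snoc_mem_V length_V noncrossing_snoc_iff)

theorem theorem4p4:
  fixes k n :: nat
  assumes "1 \<le> k" and "k \<le> n - 1"
  shows "flag_unimodular_triangulation k n (DeltaNN k n) \<and>
         flag_unimodular_triangulation k n (DeltaNC k n)"
proof -
  have "k \<le> n" using assms by simp
  then show ?thesis
    using greedy_relation.flag_unimodular_triangulation_R[OF greedy_relation_nonnesting]
      greedy_relation.flag_unimodular_triangulation_R[OF greedy_relation_noncrossing]
    by (simp add: DeltaNN_def DeltaNC_def)
qed

end
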